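(* Let $H$ be a tournament. If WMISP restricted to prime $H$-free tournaments can be solved in polynomial time, then WMISP restricted to all $H$-free tournaments can be solved in polynomial time.
   Context: All tournaments are finite. A tournament $G$ is $H$-free if no induced subtournament is isomorphic to $H$. A set $X\subseteq V(G)$ is homogeneous if for every $v\in V(G)\setminus X$ either $v\to x$ for all $x\in X$ or $x\to v$ for all $x\in X$; it is trivial if $|X|\le 1$ or $X=V(G)$. A tournament is prime if it has no nontrivial homogeneous set. A set $X \subseteq V(G)$ is independent if $G[X]$ is transitive (acyclic). WMISP: given a tournament $G$ and a weight function $w: V(G)\to \mathbb{Q}_+$, find the maximum total weight of an independent set of $G$. *)

theory Defs
  imports
    "Graph_Theory.Digraph_Component"
    "Graph_Theory.Digraph_Isomorphism"
    "HOL-Computational_Algebra.Polynomial"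
begin

locale tournament = digraph +
  assumes one_arc: "u \<in> verts G \<Longrightarrow> v \<in> verts G \<Longrightarrow> u \<noteq> v \<Longrightarrow>
    (u, v) \<in> arcs_ends G \<longleftrightarrow> (v, u) \<notin> arcs_ends G"

definition is_free_of :: "('v, 'e) pre_digraph \<Rightarrow> ('a, 'b) pre_digraph \<Rightarrow> bool" where
  "is_free_of G H \<longleftrightarrow> \<not> (\<exists>K. induced_subgraph K G \<and> digraph_iso K H)"

definition homogeneous :: "('v, 'e) pre_digraph \<Rightarrow> 'v set \<Rightarrow> bool" where
  "homogeneous G X \<longleftrightarrow> X \<subseteq> verts G \<and>
    (\<forall>v \<in> verts G - X. (\<forall>x \<in> X. (v, x) \<in> arcs_ends G) \<or> (\<forall>x \<in> X. (x, v) \<in> arcs_ends G))"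

definition trivial_homogeneous :: "('v, 'e) pre_digraph \<Rightarrow> 'v set \<Rightarrow> bool" where
  "trivial_homogeneous G X \<longleftrightarrow> card X \<le> 1 \<or> X = verts G"

definition prime_tournament :: "('v, 'e) pre_digraph \<Rightarrow> bool" where
  "prime_tournament G \<longleftrightarrow> tournament G \<and> (\<forall>X. homogeneous G X \<longrightarrow> trivial_homogeneous G X)"

definition independent_set :: "('v, 'e) pre_digraph \<Rightarrow> 'v set \<Rightarrow> bool" where
  "independent_set G X \<longleftrightarrow> X \<subseteq> verts G \<and> trans (arcs_ends (G \<restriction> X))"

definition max_independent_weight :: "('v, 'e) pre_digraph \<Rightarrow> ('v \<Rightarrow> rat) \<Rightarrow> rat" where
  "max_independent_weight G w = Max {\<Sum>v\<in>X. w v | X. independent_set G X}"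

text \<open>
  The machine model is the WHILE language over binary trees of N. D. Jones (Computability and
  Complexity from a Programming Perspective, MIT Press 1997), without its equality test, whose time
  measure charges one unit for every operation performed. Trees can be shared, so a run of
  \<^emph>\<open>t\<close> steps creates at most \<^emph>\<open>t\<close> new tree nodes, and no operation
  inspects more than the root of a tree; hence this model and Turing machines simulate each other
  with polynomial overhead, as long as the outputs (here: binary encodings of rational numbers)
  have polynomial size.
\<close>

datatype btree = Leaf | Node btree btree

fun left :: "btree \<Rightarrow> btree" where
  "left Leaf = Leaf"
| "left (Node l r) = l"

fun right :: "btree \<Rightarrow> btree" where
  "right Leaf = Leaf"
| "right (Node l r) = r"

datatype expr = Var nat | ENil | ECons expr expr | Hd expr | Tl expr

type_synonym store = "nat \<Rightarrow> btree"

primrec eval_expr :: "expr \<Rightarrow> store \<Rightarrow> btree" where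
  "eval_expr (Var x) s = s x"
| "eval_expr ENil s = Leaf"
| "eval_expr (ECons e f) s = Node (eval_expr e s) (eval_expr f s)"
| "eval_expr (Hd e) s = left (eval_expr e s)"
| "eval_expr (Tl e) s = right (eval_expr e s)"

primrec expr_time :: "expr \<Rightarrow> nat" where
  "expr_time (Var x) = 1"
| "expr_time ENil = 1"
| "expr_time (ECons e f) = expr_time e + expr_time f + 1"
| "expr_time (Hd e) = expr_time e + 1"
| "expr_time (Tl e) = expr_time e + 1"

datatype com =
    Assign nat expr
  | Seq com com
  | If expr com com
  | While expr com

text \<open>
  \<^term>\<open>Leaf\<close> counts as false, every other tree as true. The third argument of
  \<^emph>\<open>runs\<close> is the running time.
\<close>

inductive runs :: "com \<Rightarrow> store \<Rightarrow> nat \<Rightarrow> store \<Rightarrow> bool" where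
  Assign: "runs (Assign x e) s (expr_time e + 1) (s(x := eval_expr e s))"
| Seq: "runs c s t s' \<Longrightarrow> runs d s' u s'' \<Longrightarrow> runs (Seq c d) s (t + u) s''"
| IfTrue: "eval_expr e s \<noteq> Leaf \<Longrightarrow> runs c s t s' \<Longrightarrow>
    runs (If e c d) s (expr_time e + 1 + t) s'"
| IfFalse: "eval_expr e s = Leaf \<Longrightarrow> runs d s t s' \<Longrightarrow>
    runs (If e c d) s (expr_time e + 1 + t) s'"
| WhileFalse: "eval_expr e s = Leaf \<Longrightarrow> runs (While e c) s (expr_time e + 1) s"
| WhileTrue: "eval_expr e s \<noteq> Leaf \<Longrightarrow> runs c s t s' \<Longrightarrow> runs (While e c) s' u s'' \<Longrightarrow>
    runs (While e c) s (expr_time e + 1 + t + u) s''"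

text \<open>
  Input and output are passed in variable 0. A problem is given by its pairs (input, required
  output); a program solving it may behave arbitrarily on trees that are not inputs of the problem.
  The library function \<^const>\<open>size\<close> counts the \<^const>\<open>Node\<close> constructors of a tree.
\<close>

definition solvable_in_poly_time :: "(btree \<times> btree) set \<Rightarrow> bool" where
  "solvable_in_poly_time P \<longleftrightarrow> (\<exists>(c :: com) (p :: nat poly). \<forall>(x, y) \<in> P.
    \<exists>t s. runs c ((\<lambda>_. Leaf)(0 := x)) t s \<and> t \<le> poly p (size x) \<and> s 0 = y)"

primrec enc_list :: "btree list \<Rightarrow> btree" where
  "enc_list [] = Leaf"
| "enc_list (x # xs) = Node x (enc_list xs)"

definition enc_bool :: "bool \<Rightarrow> btree" where
  "enc_bool b = (if b then Node Leaf Leaf else Leaf)"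

text \<open>Binary, least significant bit first.\<close>

fun enc_nat :: "nat \<Rightarrow> btree" where
  "enc_nat n = (if n = 0 then Leaf else Node (enc_bool (odd n)) (enc_nat (n div 2)))"

declare enc_nat.simps [simp del]

text \<open>Nonnegative rationals, as fractions in lowest terms.\<close>

definition enc_rat :: "rat \<Rightarrow> btree" where
  "enc_rat r = (case quotient_of r of (a, b) \<Rightarrow> Node (enc_nat (nat a)) (enc_nat (nat b)))"

text \<open>
  An instance is encoded, relative to an enumeration \<^emph>\<open>xs\<close> of the vertices, by the list
  of the weights of the vertices, each paired with the row of the adjacency matrix of that vertex.
\<close>

definition enc_instance ::
    "'v list \<Rightarrow> ('v, 'e) pre_digraph \<Rightarrow> ('v \<Rightarrow> rat) \<Rightarrow> btree" where
  "enc_instance xs G w = enc_list (map (\<lambda>u.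
    Node (enc_rat (w u)) (enc_list (map (\<lambda>v. enc_bool ((u, v) \<in> arcs_ends G)) xs))) xs)"

definition WMISP :: "('v, 'e) pre_digraph set \<Rightarrow> (btree \<times> btree) set" where
  "WMISP \<G> = {(enc_instance xs G w, enc_rat (max_independent_weight G w)) | xs G w.
    G \<in> \<G> \<and> tournament G \<and> distinct xs \<and> set xs = verts G \<and> (\<forall>v \<in> verts G. 0 \<le> w v)}"

end

theory Submission
  imports Defs
begin

text \<open>
  Let \<open>X\<close> be a homogeneous set with at least two vertices that is minimal under inclusion. A
  homogeneous set of \<open>G[X]\<close> is homogeneous in \<open>G\<close>, so \<open>G[X]\<close> is prime, and the
  assumed algorithm finds its maximum weight \<open>W\<close> of an independent set. Replacing \<open>X\<close> by
  one of its vertices, with the weight \<open>W\<close>, leaves an induced subtournament with the same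
  maximum weight of an independent set. Such contractions reduce \<open>G\<close> to a single vertex
  (the last one has \<open>X = V(G)\<close>), whose weight is the answer. A suitable \<open>X\<close> is found
  among the closures of the pairs of vertices, where the closure of a set arises from adding vertices
  that are mixed on it. No arithmetic is needed, as \<open>W\<close> is only copied; its encoding stays
  small because it is a sum of original weights.

  On the machine side, the functions with a polynomial-time program and polynomially bounded output
  size are closed under composition, case distinction and size-bounded folds over lists, so it
  suffices to write the algorithm as a functional program.
\<close>

section \<open>Resource-bounded execution\<close>

text \<open>Running time does not bound the size of a tree: with shared subtrees, \<open>t\<close>
  assignments of the form \<open>x := ECons x x\<close> produce about 2^\<open>t\<close> nodes. A
  time bound for the assumed solver therefore says nothing about the size of its output, and every
  closure property has to carry a size bound besides a time bound. For the main loop this bound must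
  be stated in terms of the original instance; a bound relative to the previous round would be
  composed with itself once per vertex.

  The solver is moreover specified only on encodings of prime \<open>H\<close>-free tournaments.
  Computability is therefore relative to a set of admissible inputs, and the loop invariant has to
  say that each intermediate tree again encodes an \<open>H\<close>-free tournament with the same
  optimum.\<close>

inductive_cases runs_AssignE: "runs (Assign x e) s t s'"
inductive_cases runs_SeqE: "runs (Seq c d) s t s'"
inductive_cases runs_IfE: "runs (If e c d) s t s'"
inductive_cases runs_WhileE: "runs (While e c) s t s'"

lemma runs_deterministic: "runs c s t s1 \<Longrightarrow> runs c s u s2 \<Longrightarrow> s1 = s2"
proof (induction arbitrary: u s2 rule: runs.induct)
  case (Assign x e s) then show ?case by (auto elim: runs_AssignE)
next
  case (Seq c s t s' d u s'') then show ?case by (blast elim: runs_SeqE)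
next
  case (IfTrue e s c t s' d) then show ?case by (blast elim: runs_IfE)
next
  case (IfFalse e s d t s' c) then show ?case by (blast elim: runs_IfE)
next
  case (WhileFalse e s c) then show ?case by (blast elim: runs_WhileE)
next
  case (WhileTrue e s c t s' u s'') then show ?case by (blast elim: runs_WhileE)
qed

text \<open>A strict upper bound for the indices of the variables that occur, so that the variable
  with this index is itself untouched.\<close>

primrec expr_bound :: "expr \<Rightarrow> nat" where
  "expr_bound (Var x) = Suc x"
| "expr_bound ENil = 0"
| "expr_bound (ECons e f) = max (expr_bound e) (expr_bound f)"
| "expr_bound (Hd e) = expr_bound e"
| "expr_bound (Tl e) = expr_bound e"

primrec com_bound :: "com \<Rightarrow> nat" where
  "com_bound (Assign x e) = max (Suc x) (expr_bound e)"
| "com_bound (Seq c d) = max (com_bound c) (com_bound d)"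
| "com_bound (If e c d) = max (expr_bound e) (max (com_bound c) (com_bound d))"
| "com_bound (While e c) = max (expr_bound e) (com_bound c)"

lemma eval_expr_cong:
  "expr_bound e \<le> K \<Longrightarrow> (\<And>i. i < K \<Longrightarrow> r i = s i) \<Longrightarrow> eval_expr e r = eval_expr e s"
  by (induction e) auto

text \<open>The program neither reads nor writes variables from \<open>K\<close> on, so its run can
  be repeated step by step, in the same time, from any store that agrees below \<open>K\<close>.
  This moves a solver from the initial store of its specification into a larger program.\<close>

lemma runs_frame:
  assumes "runs c s t s'" "com_bound c \<le> K" "\<And>i. i < K \<Longrightarrow> r i = s i"
  shows "\<exists>r'. runs c r t r' \<and> (\<forall>i<K. r' i = s' i) \<and> (\<forall>i\<ge>K. r' i = r i)"
  using assms
proof (induction arbitrary: r rule: runs.induct)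
  case (Assign x e s)
  have "eval_expr e r = eval_expr e s" using Assign by (intro eval_expr_cong[of _ K]) auto
  then show ?case
    using Assign.prems by (intro exI[of _ "r(x := eval_expr e r)"] conjI runs.Assign) auto
next
  case (Seq c s t s' d u s'')
  from Seq.IH(1)[of r] Seq.prems obtain r1 where
    r1: "runs c r t r1" "\<forall>i<K. r1 i = s' i" "\<forall>i\<ge>K. r1 i = r i" by auto
  from Seq.IH(2)[of r1] r1 Seq.prems obtain r2 where
    "runs d r1 u r2" "\<forall>i<K. r2 i = s'' i" "\<forall>i\<ge>K. r2 i = r1 i" by auto
  with r1 show ?case by (intro exI[of _ r2] conjI runs.Seq[of c r t r1 d u r2]) auto
next
  case (IfTrue e s c t s' d)
  have "eval_expr e r = eval_expr e s" using IfTrue by (intro eval_expr_cong[of _ K]) auto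
  moreover from IfTrue.IH[of r] IfTrue.prems obtain r1 where
    "runs c r t r1" "\<forall>i<K. r1 i = s' i" "\<forall>i\<ge>K. r1 i = r i" by auto
  ultimately show ?case
    using IfTrue.hyps by (intro exI[of _ r1] conjI runs.IfTrue) auto
next
  case (IfFalse e s d t s' c)
  have "eval_expr e r = eval_expr e s" using IfFalse by (intro eval_expr_cong[of _ K]) auto
  moreover from IfFalse.IH[of r] IfFalse.prems obtain r1 where
    "runs d r t r1" "\<forall>i<K. r1 i = s' i" "\<forall>i\<ge>K. r1 i = r i" by auto
  ultimately show ?case
    using IfFalse.hyps by (intro exI[of _ r1] conjI runs.IfFalse) auto
next
  case (WhileFalse e s c)
  have "eval_expr e r = eval_expr e s" using WhileFalse by (intro eval_expr_cong[of _ K]) auto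
  then show ?case using WhileFalse by (intro exI[of _ r] conjI runs.WhileFalse) auto
next
  case (WhileTrue e s c t s' u s'')
  have e: "eval_expr e r = eval_expr e s" using WhileTrue by (intro eval_expr_cong[of _ K]) auto
  from WhileTrue.IH(1)[of r] WhileTrue.prems obtain r1 where
    r1: "runs c r t r1" "\<forall>i<K. r1 i = s' i" "\<forall>i\<ge>K. r1 i = r i" by auto
  from WhileTrue.IH(2)[of r1] r1 WhileTrue.prems obtain r2 where
    "runs (While e c) r1 u r2" "\<forall>i<K. r2 i = s'' i" "\<forall>i\<ge>K. r2 i = r1 i" by auto
  with r1 e WhileTrue.hyps show ?case
    by (intro exI[of _ r2] conjI runs.WhileTrue[of e r c t r1 u r2]) auto
qed

text \<open>A total-correctness triple with a time budget; \<open>T\<close> is only an upper bound,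
  so budgets of subprograms can be added up and rounded.\<close>

definition terminates_within :: "com \<Rightarrow> store \<Rightarrow> nat \<Rightarrow> (store \<Rightarrow> bool) \<Rightarrow> bool" where
  "terminates_within c s T Q \<longleftrightarrow> (\<exists>t s'. runs c s t s' \<and> t \<le> T \<and> Q s')"

lemma terminates_within_mono:
  "terminates_within c s T Q \<Longrightarrow> T \<le> T' \<Longrightarrow> (\<And>s'. Q s' \<Longrightarrow> Q' s') \<Longrightarrow> terminates_within c s T' Q'"
  unfolding terminates_within_def by (meson le_trans)

lemma terminates_within_Assign:
  "Q (s(x := eval_expr e s)) \<Longrightarrow> terminates_within (Assign x e) s (expr_time e + 1) Q"
  unfolding terminates_within_def by (blast intro: runs.Assign)

lemma terminates_within_Seq:
  assumes "terminates_within c s T P" "\<And>s'. P s' \<Longrightarrow> terminates_within d s' U Q"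
  shows "terminates_within (Seq c d) s (T + U) Q"
  using assms unfolding terminates_within_def by (meson add_mono runs.Seq)

lemma terminates_within_Assign_Seq:
  assumes "terminates_within d (s(x := eval_expr e s)) U Q"
  shows "terminates_within (Seq (Assign x e) d) s (expr_time e + 1 + U) Q"
  by (rule terminates_within_Seq[OF terminates_within_Assign[where Q="\<lambda>r. r = s(x := eval_expr e s)"]])
    (use assms in auto)

lemma terminates_within_If:
  assumes "eval_expr e s \<noteq> Leaf \<Longrightarrow> terminates_within c s U Q"
    and "eval_expr e s = Leaf \<Longrightarrow> terminates_within d s U Q"
  shows "terminates_within (If e c d) s (expr_time e + 1 + U) Q"
  using assms unfolding terminates_within_def
  by (cases "eval_expr e s = Leaf") (meson add_left_mono runs.IfFalse runs.IfTrue)+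

section \<open>Polynomial-time computable functions on trees\<close>

text \<open>Natural coefficients make polynomials monotone, so a bound in terms of an intermediate
  size turns into one in terms of the input size.\<close>

lemma poly_nat_mono: "m \<le> n \<Longrightarrow> poly (p :: nat poly) m \<le> poly p n"
  by (induction p) (auto intro: mult_mono add_mono)

text \<open>
  The program may start from an arbitrary store, so that it can be reused inside a larger program;
  the variables from \<open>K\<close> on survive it.
\<close>

definition computes :: "btree set \<Rightarrow> (btree \<Rightarrow> btree) \<Rightarrow> com \<Rightarrow> nat \<Rightarrow> nat poly \<Rightarrow> bool" where
  "computes D f c K p \<longleftrightarrow> 0 < K \<and> (\<forall>s. s 0 \<in> D \<longrightarrow> size (f (s 0)) \<le> poly p (size (s 0)) \<and>
    terminates_within c s (poly p (size (s 0))) (\<lambda>s'. s' 0 = f (s 0) \<and> (\<forall>i\<ge>K. s' i = s i)))"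

definition FP :: "btree set \<Rightarrow> (btree \<Rightarrow> btree) \<Rightarrow> bool" where
  "FP D f \<longleftrightarrow> (\<exists>c K p. computes D f c K p)"

lemma computes_mono:
  assumes "computes D f c K p" "K \<le> K'" "\<And>n. poly p n \<le> poly p' n"
  shows "computes D f c K' p'"
  using assms unfolding computes_def by (auto elim!: terminates_within_mono intro: le_trans)

lemma computes_size: "computes D f c K p \<Longrightarrow> x \<in> D \<Longrightarrow> size (f x) \<le> poly p (size x)"
  unfolding computes_def by (metis fun_upd_same)

lemma computesD:
  assumes "computes D f c K p" "s 0 = x" "x \<in> D"
  shows "terminates_within c s (poly p (size x)) (\<lambda>s'. s' 0 = f x \<and> (\<forall>i\<ge>K. s' i = s i))"
  using assms unfolding computes_def by auto

lemma FP_size_bound: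
  assumes "FP D f"
  obtains p :: "nat poly" where "\<And>x. x \<in> D \<Longrightarrow> size (f x) \<le> poly p (size x)"
  using assms computes_size unfolding FP_def by metis

text \<open>A common \<open>K\<close> leaves the variables from \<open>K\<close> on free as
  registers around both programs, and a common polynomial serves all their bounds.\<close>

lemma FP_obtain2:
  assumes "FP D f" "FP E g"
  obtains c d K p where "0 < K" "computes D f c K p" "computes E g d K p"
proof -
  from assms obtain c1 K1 p1 c2 K2 p2 where *: "computes D f c1 K1 p1" "computes E g c2 K2 p2"
    unfolding FP_def by auto
  then have "0 < max K1 K2" by (auto simp: computes_def)
  moreover from * have "computes D f c1 (max K1 K2) (p1 + p2)" "computes E g c2 (max K1 K2) (p1 + p2)"
    by (auto elim!: computes_mono)
  ultimately show thesis by (rule that)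
qed

lemma FP_obtain3:
  assumes "FP D f" "FP E g" "FP F h"
  obtains c d e K p where "0 < K" "computes D f c K p" "computes E g d K p" "computes F h e K p"
proof -
  from assms obtain c1 K1 p1 c2 K2 p2 c3 K3 p3 where
    *: "computes D f c1 K1 p1" "computes E g c2 K2 p2" "computes F h c3 K3 p3"
    unfolding FP_def by auto
  let ?K = "max K1 (max K2 K3)" and ?p = "p1 + p2 + p3"
  from * have "0 < ?K" by (auto simp: computes_def)
  moreover from * have "computes D f c1 ?K ?p" "computes E g c2 ?K ?p" "computes F h c3 ?K ?p"
    by (auto elim!: computes_mono)
  ultimately show thesis by (rule that)
qed

lemma FP_subset:
  assumes "FP D f" "E \<subseteq> D"
  shows "FP E f"
proof -
  from assms(1) obtain c K p where "computes D f c K p" unfolding FP_def by auto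
  with assms(2) have "computes E f c K p" unfolding computes_def by auto
  then show ?thesis unfolding FP_def by blast
qed

lemma FP_cong:
  assumes "FP D f" "\<And>x. x \<in> D \<Longrightarrow> f x = g x"
  shows "FP D g"
proof -
  from assms(1) obtain c K p where "computes D f c K p" unfolding FP_def by auto
  with assms(2) have "computes D g c K p" unfolding computes_def by auto
  then show ?thesis unfolding FP_def by blast
qed

lemma size_left_le: "size (left x) \<le> size x" and size_right_le: "size (right x) \<le> size x"
  by (cases x; simp)+

lemma FP_expr:
  assumes "\<And>s. eval_expr e s = f (s 0)" "\<And>x. size (f x) \<le> size x"
  shows "FP D f"
  unfolding FP_def computes_def
proof (intro exI conjI allI impI)
  fix s :: store
  let ?p = "[:expr_time e + 1, 1:]"
  have p: "poly ?p n = expr_time e + 1 + n" for n by simp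
  show "size (f (s 0)) \<le> poly ?p (size (s 0))"
    using assms(2)[of "s 0"] by (simp only: p)
  show "terminates_within (Assign 0 e) s (poly ?p (size (s 0)))
      (\<lambda>s'. s' 0 = f (s 0) \<and> (\<forall>i\<ge>1. s' i = s i))"
    by (rule terminates_within_mono[OF terminates_within_Assign
        [where Q="(\<lambda>s'. s' 0 = f (s 0) \<and> (\<forall>i\<ge>1. s' i = s i))"]])
      (use assms(1) in auto)
qed simp

lemma FP_id: "FP D (\<lambda>x. x)"
  by (rule FP_expr[of "Var 0"]) auto

lemma FP_Leaf: "FP D (\<lambda>x. Leaf)"
  by (rule FP_expr[of ENil]) auto

lemma FP_comp:
  assumes "FP D f" "FP E g" "\<And>x. x \<in> D \<Longrightarrow> f x \<in> E"
  shows "FP D (\<lambda>x. g (f x))"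
proof -
  obtain c d K p where cd: "0 < K" "computes D f c K p" "computes E g d K p"
    using FP_obtain2[OF assms(1,2)] .
  \<comment> \<open>The second program runs on an input of size up to \<open>poly p n\<close>, where
    \<open>n\<close> is the original size; this is where the size clause of \<open>computes\<close>
    pays off.\<close>
  have "computes D (\<lambda>x. g (f x)) (Seq c d) K (p + pcompose p p)"
    unfolding computes_def
  proof (intro conjI allI impI)
    fix s :: store assume s: "s 0 \<in> D"
    have sz: "poly p (size (f (s 0))) \<le> poly (pcompose p p) (size (s 0))"
      using computes_size[OF cd(2) s] by (simp add: poly_pcompose poly_nat_mono)
    show "size (g (f (s 0))) \<le> poly (p + pcompose p p) (size (s 0))"
      using computes_size[OF cd(3) assms(3)[OF s]] sz by simp
    have "terminates_within (Seq c d) s (poly p (size (s 0)) + poly p (size (f (s 0))))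
      (\<lambda>s'. s' 0 = g (f (s 0)) \<and> (\<forall>i\<ge>K. s' i = s i))"
    proof (rule terminates_within_Seq[OF computesD[where s = s, OF cd(2) refl s]])
      fix s' assume s': "s' 0 = f (s 0) \<and> (\<forall>i\<ge>K. s' i = s i)"
      show "terminates_within d s' (poly p (size (f (s 0))))
          (\<lambda>s'. s' 0 = g (f (s 0)) \<and> (\<forall>i\<ge>K. s' i = s i))"
        by (rule terminates_within_mono[OF computesD[where s = s', OF cd(3) conjunct1[OF s'] assms(3)[OF s]]])
          (use s' in auto)
    qed
    then show "terminates_within (Seq c d) s (poly (p + pcompose p p) (size (s 0)))
      (\<lambda>s'. s' 0 = g (f (s 0)) \<and> (\<forall>i\<ge>K. s' i = s i))"
      by (rule terminates_within_mono) (use sz in auto)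
  qed (rule cd)
  then show ?thesis unfolding FP_def by blast
qed

lemma FP_left: "FP D f \<Longrightarrow> FP D (\<lambda>x. left (f x))"
  by (rule FP_comp[OF _ FP_expr[of "Hd (Var 0)" _ UNIV]]) (auto simp: size_left_le)

lemma FP_right: "FP D f \<Longrightarrow> FP D (\<lambda>x. right (f x))"
  by (rule FP_comp[OF _ FP_expr[of "Tl (Var 0)" _ UNIV]]) (auto simp: size_right_le)

lemma FP_Node:
  assumes "FP D f" "FP D g"
  shows "FP D (\<lambda>x. Node (f x) (g x))"
proof -
  obtain c d K p where cd: "0 < K" "computes D f c K p" "computes D g d K p"
    using FP_obtain2[OF assms] .
  \<comment> \<open>Register \<open>K\<close> keeps the input for the second program and
    \<open>Suc K\<close> keeps the first result. The four assignments cost 2 + 2 + 2 + 4 =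
    10.\<close>
  let ?c = "Seq (Assign K (Var 0)) (Seq c (Seq (Assign (Suc K) (Var 0)) (Seq (Assign 0 (Var K))
    (Seq d (Assign 0 (ECons (Var (Suc K)) (Var 0)))))))"
  have "computes D (\<lambda>x. Node (f x) (g x)) ?c (K + 2) (p + p + [:10:])"
    unfolding computes_def
  proof (intro conjI allI impI)
    fix s :: store assume s: "s 0 \<in> D"
    let ?P = "\<lambda>s'. s' 0 = Node (f (s 0)) (g (s 0)) \<and> (\<forall>i\<ge>K + 2. s' i = s i)"
    show "size (Node (f (s 0)) (g (s 0))) \<le> poly (p + p + [:10:]) (size (s 0))"
      using computes_size[OF cd(2) s] computes_size[OF cd(3) s] by simp
    have "terminates_within ?c s (expr_time (Var 0) + 1 + (poly p (size (s 0)) + (expr_time (Var 0) + 1 +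
      (expr_time (Var 0) + 1 + (poly p (size (s 0)) + (expr_time (ECons (Var (Suc K)) (Var 0)) + 1)))))) ?P"
    proof (rule terminates_within_Assign_Seq, rule terminates_within_Seq)
      let ?s = "s(K := eval_expr (Var 0) s)"
      show "terminates_within c ?s (poly p (size (s 0)))
        (\<lambda>s'. s' 0 = f (s 0) \<and> (\<forall>i\<ge>K. s' i = ?s i))"
        by (rule computesD[OF cd(2)]) (use cd s in auto)
      fix s1 assume s1: "s1 0 = f (s 0) \<and> (\<forall>i\<ge>K. s1 i = ?s i)"
      let ?s2 = "s1(Suc K := eval_expr (Var 0) s1)"
      let ?s3 = "?s2(0 := eval_expr (Var K) ?s2)"
      show "terminates_within (Seq (Assign (Suc K) (Var 0)) (Seq (Assign 0 (Var K))
          (Seq d (Assign 0 (ECons (Var (Suc K)) (Var 0)))))) s1 (expr_time (Var 0) + 1 +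
        (expr_time (Var 0) + 1 + (poly p (size (s 0)) + (expr_time (ECons (Var (Suc K)) (Var 0)) + 1)))) ?P"
      proof (rule terminates_within_Assign_Seq, rule terminates_within_mono,
          rule terminates_within_Assign_Seq, rule terminates_within_Seq)
        show "terminates_within d ?s3 (poly p (size (s 0)))
          (\<lambda>s'. s' 0 = g (s 0) \<and> (\<forall>i\<ge>K. s' i = ?s3 i))"
          by (rule computesD[OF cd(3)]) (use cd s1 s in auto)
        fix s4 assume "s4 0 = g (s 0) \<and> (\<forall>i\<ge>K. s4 i = ?s3 i)"
        then show "terminates_within (Assign 0 (ECons (Var (Suc K)) (Var 0))) s4
            (expr_time (ECons (Var (Suc K)) (Var 0)) + 1) ?P"
          by (intro terminates_within_Assign) (use cd(1) s1 in auto)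
      qed auto
    qed
    then show "terminates_within ?c s (poly (p + p + [:10:]) (size (s 0))) ?P"
      by (rule terminates_within_mono) auto
  qed simp
  then show ?thesis unfolding FP_def by blast
qed

text \<open>Each branch has to be computable only on the inputs that reach it. This guards the call
  of the solver, whose behaviour is known on valid inputs only.\<close>

lemma FP_If:
  assumes "FP D b" "FP {x \<in> D. b x \<noteq> Leaf} f" "FP {x \<in> D. b x = Leaf} g"
  shows "FP D (\<lambda>x. if b x \<noteq> Leaf then f x else g x)"
proof -
  obtain a c d K p where cd: "0 < K" "computes D b a K p" "computes {x \<in> D. b x \<noteq> Leaf} f c K p"
      "computes {x \<in> D. b x = Leaf} g d K p"
    using FP_obtain3[OF assms] .
  let ?c = "Seq (Assign K (Var 0)) (Seq a
    (If (Var 0) (Seq (Assign 0 (Var K)) c) (Seq (Assign 0 (Var K)) d)))"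
  let ?h = "\<lambda>x. if b x \<noteq> Leaf then f x else g x"
  have "computes D ?h ?c (K + 1) (p + p + [:6:])"
    unfolding computes_def
  proof (intro conjI allI impI)
    fix s :: store assume s: "s 0 \<in> D"
    let ?P = "\<lambda>s'. s' 0 = ?h (s 0) \<and> (\<forall>i\<ge>K + 1. s' i = s i)"
    show "size (?h (s 0)) \<le> poly (p + p + [:6:]) (size (s 0))"
      using computes_size[OF cd(3), of "s 0"] computes_size[OF cd(4), of "s 0"] s by auto
    have "terminates_within ?c s (expr_time (Var 0) + 1 + (poly p (size (s 0)) + (expr_time (Var 0) + 1 +
      (expr_time (Var K) + 1 + poly p (size (s 0)))))) ?P"
    proof (rule terminates_within_Assign_Seq, rule terminates_within_Seq)
      let ?s = "s(K := eval_expr (Var 0) s)"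
      show "terminates_within a ?s (poly p (size (s 0)))
        (\<lambda>s'. s' 0 = b (s 0) \<and> (\<forall>i\<ge>K. s' i = ?s i))"
        by (rule computesD[OF cd(2)]) (use cd s in auto)
      fix s1 assume s1: "s1 0 = b (s 0) \<and> (\<forall>i\<ge>K. s1 i = ?s i)"
      let ?s2 = "s1(0 := eval_expr (Var K) s1)"
      have s2: "?s2 0 = s 0" using s1 cd(1) by auto
      show "terminates_within (If (Var 0) (Seq (Assign 0 (Var K)) c) (Seq (Assign 0 (Var K)) d)) s1
        (expr_time (Var 0) + 1 + (expr_time (Var K) + 1 + poly p (size (s 0)))) ?P"
      proof (rule terminates_within_If)
        assume n: "eval_expr (Var 0) s1 \<noteq> Leaf"
        show "terminates_within (Seq (Assign 0 (Var K)) c) s1 (expr_time (Var K) + 1 + poly p (size (s 0))) ?P"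
          by (rule terminates_within_Assign_Seq, rule terminates_within_mono[OF computesD[where s = ?s2, OF cd(3) s2]])
            (use s n s1 cd(1) in auto)
      next
        assume n: "eval_expr (Var 0) s1 = Leaf"
        show "terminates_within (Seq (Assign 0 (Var K)) d) s1 (expr_time (Var K) + 1 + poly p (size (s 0))) ?P"
          by (rule terminates_within_Assign_Seq, rule terminates_within_mono[OF computesD[where s = ?s2, OF cd(4) s2]])
            (use s n s1 cd(1) in auto)
      qed
    qed
    then show "terminates_within ?c s (poly (p + p + [:6:]) (size (s 0))) ?P"
      by (rule terminates_within_mono) auto
  qed simp
  then show ?thesis unfolding FP_def by blast
qed

section \<open>Lists coded as trees, and loops over them\<close>

primrec dec_list :: "btree \<Rightarrow> btree list" where
  "dec_list Leaf = []"
| "dec_list (Node x t) = x # dec_list t"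

lemma dec_enc_list [simp]: "dec_list (enc_list xs) = xs"
  by (induction xs) auto

lemma enc_dec_list [simp]: "enc_list (dec_list t) = t"
  by (induction t) auto

lemma size_enc_list: "size (enc_list xs) = length xs + sum_list (map size xs)"
  by (induction xs) auto

lemma length_dec_list_le: "length (dec_list t) \<le> size t"
  by (metis enc_dec_list le_add1 size_enc_list)

lemma size_mem_dec_list: "x \<in> set (dec_list t) \<Longrightarrow> size x < size t"
  by (induction t) auto

text \<open>Registers \<open>K\<close>, \<open>K + 1\<close> and \<open>K + 2\<close> hold the
  parameter, the rest of the list and the accumulator. The hypothesis on the body speaks of folds
  over prefixes, which admits a body that is correct on reachable states only. The 20 exceeds the
  fixed cost of a round, and the 2 is the final failing test.\<close>

lemma terminates_within_fold_loop:
  fixes step :: "btree \<Rightarrow> btree \<Rightarrow> btree"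
  assumes "0 < K" "s K = x" "s (K + 1) = enc_list zs" "s (K + 2) = a"
    and step: "\<And>ys z zs' s. zs = ys @ z # zs' \<Longrightarrow> s 0 = Node x (Node z (fold step ys a)) \<Longrightarrow>
      terminates_within d s T (\<lambda>s'. s' 0 = step z (fold step ys a) \<and> (\<forall>i\<ge>K. s' i = s i))"
  shows "terminates_within (While (Var (K + 1))
      (Seq (Assign 0 (ECons (Var K) (ECons (Hd (Var (K + 1))) (Var (K + 2)))))
      (Seq d (Seq (Assign (K + 2) (Var 0)) (Assign (K + 1) (Tl (Var (K + 1)))))))) s
    (length zs * (T + 20) + 2)
    (\<lambda>s'. s' (K + 2) = fold step zs a \<and> (\<forall>i\<ge>K + 3. s' i = s i))"
    (is "terminates_within ?W s _ _")
  using assms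
proof (induction zs arbitrary: s a)
  case Nil
  have "runs ?W s (expr_time (Var (K + 1)) + 1) s" by (rule runs.WhileFalse) (use Nil in simp)
  with Nil show ?case unfolding terminates_within_def
    by (intro exI[of _ "expr_time (Var (K + 1)) + 1"] exI[of _ s]) auto
next
  case (Cons z zs)
  let ?e = "ECons (Var K) (ECons (Hd (Var (K + 1))) (Var (K + 2)))"
  let ?s1 = "s(0 := eval_expr ?e s)"
  have s1: "?s1 0 = Node x (Node z (fold step [] a))" using Cons.prems by simp
  have "terminates_within (Seq (Assign 0 ?e)
      (Seq d (Seq (Assign (K + 2) (Var 0)) (Assign (K + 1) (Tl (Var (K + 1))))))) s
      (expr_time ?e + 1 + (T + (expr_time (Var 0) + 1 + (expr_time (Tl (Var (K + 1))) + 1))))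
      (\<lambda>s'. s' K = x \<and> s' (K + 1) = enc_list zs \<and> s' (K + 2) = step z a \<and> (\<forall>i\<ge>K+3. s' i = s i))"
    by (rule terminates_within_Assign_Seq,
        rule terminates_within_Seq[OF Cons.prems(5)[where ys = "[]" and s = ?s1, OF _ s1]],
        simp, rule terminates_within_Assign_Seq, rule terminates_within_Assign)
      (use Cons.prems in auto)
  then obtain t1 s' where t1: "runs (Seq (Assign 0 ?e)
      (Seq d (Seq (Assign (K + 2) (Var 0)) (Assign (K + 1) (Tl (Var (K + 1))))))) s t1 s'"
    "t1 \<le> T + 15" and s': "s' K = x" "s' (K + 1) = enc_list zs" "s' (K + 2) = step z a"
      "\<forall>i\<ge>K+3. s' i = s i"
    unfolding terminates_within_def by auto
  have "terminates_within ?W s' (length zs * (T + 20) + 2)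
    (\<lambda>s''. s'' (K + 2) = fold step zs (step z a) \<and> (\<forall>i\<ge>K + 3. s'' i = s' i))"
    by (rule Cons.IH[OF Cons.prems(1) s'(1,2,3)])
      (use Cons.prems(5)[of "z # ys" for ys] in auto)
  then obtain t2 s'' where t2: "runs ?W s' t2 s''" "t2 \<le> length zs * (T + 20) + 2"
    "s'' (K + 2) = fold step zs (step z a)" "\<forall>i\<ge>K + 3. s'' i = s' i"
    unfolding terminates_within_def by auto
  have "runs ?W s (expr_time (Var (K + 1)) + 1 + t1 + t2) s''"
    by (rule runs.WhileTrue[OF _ t1(1) t2(1)]) (use Cons.prems in simp)
  then show ?case unfolding terminates_within_def using t1 t2 s'
    by (intro exI[of _ "expr_time (Var (K + 1)) + 1 + t1 + t2"] exI[of _ s'']) auto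
qed

text \<open>
  The size hypothesis cannot be dropped: with a doubling step the accumulator would grow
  exponentially.
\<close>

lemma FP_fold:
  assumes "FP D l" "FP D i"
    and "FP E (\<lambda>z. step (left z) (left (right z)) (right (right z)))"
    and E: "\<And>x ys y zs. x \<in> D \<Longrightarrow> dec_list (l x) = ys @ y # zs \<Longrightarrow>
      Node x (Node y (fold (step x) ys (i x))) \<in> E"
    and q: "\<And>x ys zs. x \<in> D \<Longrightarrow> dec_list (l x) = ys @ zs \<Longrightarrow>
      size (fold (step x) ys (i x)) \<le> poly q (size x)"
  shows "FP D (\<lambda>x. fold (step x) (dec_list (l x)) (i x))"
proof -
  obtain cl ci d K p where cd: "0 < K" "computes D l cl K p" "computes D i ci K p"
      "computes E (\<lambda>z. step (left z) (left (right z)) (right (right z))) d K p"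
    using FP_obtain3[OF assms(1-3)] .
  let ?W = "While (Var (K + 1))
      (Seq (Assign 0 (ECons (Var K) (ECons (Hd (Var (K + 1))) (Var (K + 2)))))
      (Seq d (Seq (Assign (K + 2) (Var 0)) (Assign (K + 1) (Tl (Var (K + 1)))))))"
  let ?c = "Seq (Assign K (Var 0)) (Seq cl (Seq (Assign (K + 1) (Var 0)) (Seq (Assign 0 (Var K))
    (Seq ci (Seq (Assign (K + 2) (Var 0)) (Seq ?W (Assign 0 (Var (K + 2)))))))))"
  let ?h = "\<lambda>x. fold (step x) (dec_list (l x)) (i x)"
  \<comment> \<open>A call of the body has the input \<open>Node x (Node y a)\<close>: two nodes,
    the parameter of size \<open>n\<close>, a list element of size at most \<open>poly p n\<close>
    and an accumulator of size at most \<open>poly q n\<close>.\<close>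
  let ?T = "pcompose p ([:2, 1:] + p + q)"
  let ?p = "p + p + q + p * (?T + [:20:]) + [:20:]"
  have "computes D ?h ?c (K + 3) ?p"
    unfolding computes_def
  proof (intro conjI allI impI)
    fix s :: store assume s: "s 0 \<in> D"
    define x where "x = s 0"
    define n where "n = size x"
    have x: "x \<in> D" using s by (simp add: x_def)
    let ?P = "\<lambda>s'. s' 0 = ?h x \<and> (\<forall>i\<ge>K + 3. s' i = s i)"
    show "size (?h (s 0)) \<le> poly ?p (size (s 0))"
      using q[OF x, of _ "[]"] unfolding x_def[symmetric] by (simp add: trans_le_add1 trans_le_add2)
    have len: "length (dec_list (l x)) \<le> poly p n"
      using length_dec_list_le[of "l x"] computes_size[OF cd(2) x] by (simp add: n_def)
    have "terminates_within ?c s (expr_time (Var 0) + 1 + (poly p n + (expr_time (Var 0) + 1 +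
      (expr_time (Var 0) + 1 + (poly p n + (expr_time (Var 0) + 1 +
        (length (dec_list (l x)) * (poly ?T n + 20) + 2 + (expr_time (Var (K + 2)) + 1)))))))) ?P"
    proof (rule terminates_within_Assign_Seq, rule terminates_within_Seq)
      let ?s = "s(K := eval_expr (Var 0) s)"
      show "terminates_within cl ?s (poly p n) (\<lambda>s'. s' 0 = l x \<and> (\<forall>i\<ge>K. s' i = ?s i))"
        unfolding n_def by (rule computesD[OF cd(2)]) (use cd x x_def in auto)
      fix s1 assume s1: "s1 0 = l x \<and> (\<forall>i\<ge>K. s1 i = ?s i)"
      let ?s2 = "s1(K + 1 := eval_expr (Var 0) s1)"
      let ?s3 = "?s2(0 := eval_expr (Var K) ?s2)"
      show "terminates_within (Seq (Assign (K + 1) (Var 0)) (Seq (Assign 0 (Var K))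
          (Seq ci (Seq (Assign (K + 2) (Var 0)) (Seq ?W (Assign 0 (Var (K + 2)))))))) s1
        (expr_time (Var 0) + 1 + (expr_time (Var 0) + 1 + (poly p n + (expr_time (Var 0) + 1 +
        (length (dec_list (l x)) * (poly ?T n + 20) + 2 + (expr_time (Var (K + 2)) + 1)))))) ?P"
      proof (rule terminates_within_Assign_Seq, rule terminates_within_mono,
          rule terminates_within_Assign_Seq, rule terminates_within_Seq)
        show "terminates_within ci ?s3 (poly p n) (\<lambda>s'. s' 0 = i x \<and> (\<forall>i\<ge>K. s' i = ?s3 i))"
          unfolding n_def by (rule computesD[OF cd(3)]) (use cd s1 x x_def in auto)
        fix s4 assume s4: "s4 0 = i x \<and> (\<forall>i\<ge>K. s4 i = ?s3 i)"
        let ?s5 = "s4(K + 2 := eval_expr (Var 0) s4)"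
        show "terminates_within (Seq (Assign (K + 2) (Var 0)) (Seq ?W (Assign 0 (Var (K + 2))))) s4
            (expr_time (Var 0) + 1 + (length (dec_list (l x)) * (poly ?T n + 20) + 2 +
             (expr_time (Var (K + 2)) + 1))) ?P"
        proof (rule terminates_within_Assign_Seq, rule terminates_within_Seq)
          show "terminates_within ?W ?s5 (length (dec_list (l x)) * (poly ?T n + 20) + 2)
             (\<lambda>s'. s' (K + 2) = ?h x \<and> (\<forall>i\<ge>K + 3. s' i = ?s5 i))"
          proof (rule terminates_within_fold_loop[where x = x])
            fix ys y zs and r :: store
            assume y: "dec_list (l x) = ys @ y # zs" and r: "r 0 = Node x (Node y (fold (step x) ys (i x)))"
            have "size y \<le> poly p n"
              using size_mem_dec_list[of y "l x"] y computes_size[OF cd(2) x] by (simp add: n_def)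
            moreover have "size (fold (step x) ys (i x)) \<le> poly q n"
              using q[OF x y] by (simp add: n_def)
            ultimately have "poly p (size (Node x (Node y (fold (step x) ys (i x))))) \<le> poly ?T n"
              by (simp add: poly_pcompose n_def poly_nat_mono)
            then show "terminates_within d r (poly ?T n)
              (\<lambda>s'. s' 0 = step x y (fold (step x) ys (i x)) \<and> (\<forall>i\<ge>K. s' i = r i))"
              using computesD[where s = r, OF cd(4) refl] E[OF x y]
              unfolding r by (auto elim: terminates_within_mono)
          qed (use cd(1) s4 s1 in \<open>auto simp: x_def\<close>)
        next
          fix s6 assume "s6 (K + 2) = ?h x \<and> (\<forall>i\<ge>K + 3. s6 i = ?s5 i)"
          then show "terminates_within (Assign 0 (Var (K + 2))) s6 (expr_time (Var (K + 2)) + 1) ?P"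
            by (intro terminates_within_Assign) (use cd(1) s1 s4 in auto)
        qed
      qed auto
    qed
    moreover have "length (dec_list (l x)) * (poly ?T n + 20) \<le> poly (p * (?T + [:20:])) n"
      using len by (simp add: mult_right_mono)
    ultimately show "terminates_within ?c s (poly ?p (size (s 0)))
        (\<lambda>s'. s' 0 = ?h (s 0) \<and> (\<forall>i\<ge>K + 3. s' i = s i))"
      unfolding x_def[symmetric] n_def[symmetric] by (elim terminates_within_mono) (auto simp del: poly_mult)
  qed simp
  then show ?thesis unfolding FP_def by blast
qed

section \<open>Solvable problems and computable functions\<close>

primrec clear_vars :: "nat \<Rightarrow> com \<Rightarrow> com" where
  "clear_vars 0 c = c"
| "clear_vars (Suc n) c = Seq (Assign (Suc n) ENil) (clear_vars n c)"

text \<open>The specification of a solver presupposes \<open>Leaf\<close> in all variables but 0,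
  while a program inside a larger one finds arbitrary values there; clearing the variables 1 to
  \<open>n\<close> repairs this at cost 2 each.\<close>

lemma terminates_within_clear_vars:
  assumes "terminates_within c (\<lambda>i. if 1 \<le> i \<and> i \<le> n then Leaf else s i) T Q"
  shows "terminates_within (clear_vars n c) s (2 * n + T) Q"
  using assms
proof (induction n arbitrary: s)
  case 0
  have "(\<lambda>i. if 1 \<le> i \<and> i \<le> 0 then Leaf else s i) = s" by auto
  with 0 show ?case by simp
next
  case (Suc n)
  have "terminates_within (clear_vars (Suc n) c) s (expr_time ENil + 1 + (2 * n + T)) Q"
    unfolding clear_vars.simps
    by (rule terminates_within_Assign_Seq, rule Suc.IH)
      (use Suc.prems in \<open>auto elim!: back_subst[where P="\<lambda>s. terminates_within _ s _ _"]\<close>)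
  then show ?case by simp
qed

text \<open>The time bound is inherited from the program; a size bound must be supplied, because
  running time does not limit the size of a tree with shared parts.\<close>

lemma FP_if_solvable:
  assumes "solvable_in_poly_time P"
  obtains f where "\<And>x y. (x, y) \<in> P \<Longrightarrow> f x = y"
    and "\<And>D q. D \<subseteq> Domain P \<Longrightarrow> (\<And>x. x \<in> D \<Longrightarrow> size (f x) \<le> poly q (size x)) \<Longrightarrow> FP D f"
proof -
  from assms obtain c p where c: "\<And>x y. (x, y) \<in> P \<Longrightarrow>
      terminates_within c ((\<lambda>_. Leaf)(0 := x)) (poly p (size x)) (\<lambda>s. s 0 = y)"
    unfolding solvable_in_poly_time_def terminates_within_def by (fast)
  define f where "f x = (SOME y. (x, y) \<in> P)" for x
  \<comment> \<open>Determinism of the solver makes \<open>P\<close> single-valued: two required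
    outputs for one input would both be the final content of variable 0 in the same run.\<close>
  have f: "f x = y" if "(x, y) \<in> P" for x y
  proof -
    have "(x, f x) \<in> P" unfolding f_def using that by (rule someI)
    from c[OF this] c[OF that] show ?thesis
      unfolding terminates_within_def using runs_deterministic by metis
  qed
  moreover have "FP D f" if D: "D \<subseteq> Domain P" "\<And>x. x \<in> D \<Longrightarrow> size (f x) \<le> poly q (size x)" for D q
  proof -
    \<comment> \<open>The maximum with 1 puts variable 0, which carries input and output, below
      \<open>?K\<close>. Clearing includes variable \<open>?K\<close> itself, hence the preserved
      variables start at \<open>Suc ?K\<close>.\<close>
    let ?K = "max 1 (com_bound c)" let ?p = "p + q + [:2 * ?K:]"
    have "computes D f (clear_vars ?K c) (Suc ?K) ?p"
      unfolding computes_def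
    proof (intro conjI allI impI)
      fix s :: store assume s: "s 0 \<in> D"
      show "size (f (s 0)) \<le> poly ?p (size (s 0))" using D(2)[OF s] by simp
      from s D obtain y where y: "(s 0, y) \<in> P" by auto
      let ?r = "\<lambda>i. if 1 \<le> i \<and> i \<le> ?K then Leaf else s i"
      from c[OF y] obtain t s' where s': "runs c ((\<lambda>_. Leaf)(0 := s 0)) t s'" "t \<le> poly p (size (s 0))"
        "s' 0 = y" unfolding terminates_within_def by auto
      obtain r' where r': "runs c ?r t r'" "\<forall>i<?K. r' i = s' i" "\<forall>i\<ge>?K. r' i = ?r i"
      proof -
        have "\<And>i. i < ?K \<Longrightarrow> ?r i = ((\<lambda>_. Leaf)(0 := s 0)) i" by auto
        from runs_frame[OF s'(1) max.cobounded2 this] that show thesis by blast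
      qed
      have "r' 0 = f (s 0)" using r'(2) s'(3) f[OF y] by simp
      then have "terminates_within c ?r (poly p (size (s 0)))
          (\<lambda>s'. s' 0 = f (s 0) \<and> (\<forall>i\<ge>Suc ?K. s' i = s i))"
        unfolding terminates_within_def using r' s'
        by (intro exI[of _ t] exI[of _ r']) auto
      then have "terminates_within (clear_vars ?K c) s (2 * ?K + poly p (size (s 0)))
          (\<lambda>s'. s' 0 = f (s 0) \<and> (\<forall>i\<ge>Suc ?K. s' i = s i))"
        by (rule terminates_within_clear_vars)
      then show "terminates_within (clear_vars ?K c) s (poly ?p (size (s 0)))
          (\<lambda>s'. s' 0 = f (s 0) \<and> (\<forall>i\<ge>Suc ?K. s' i = s i))"
        by (rule terminates_within_mono) auto
    qed simp
    then show ?thesis unfolding FP_def by blast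
  qed
  ultimately show thesis by (rule that)
qed

lemma solvable_if_FP:
  assumes "FP D f" "\<And>x y. (x, y) \<in> P \<Longrightarrow> x \<in> D \<and> f x = y"
  shows "solvable_in_poly_time P"
proof -
  from assms(1) obtain c K p where c: "computes D f c K p" unfolding FP_def by auto
  show ?thesis unfolding solvable_in_poly_time_def
  proof (intro exI[of _ c] exI[of _ p] ballI, clarify)
    fix x y assume "(x, y) \<in> P"
    with assms(2) have "x \<in> D" "f x = y" by auto
    with computesD[OF c, of "(\<lambda>_. Leaf)(0 := x)" x]
    show "\<exists>t s. runs c ((\<lambda>_. Leaf)(0 := x)) t s \<and> t \<le> poly p (size x) \<and> s 0 = y"
      unfolding terminates_within_def by auto
  qed
qed

text \<open>Several arguments are packed into pairs. The operations below are total on trees, so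
  their computability can be stated on \<open>UNIV\<close> and then instantiated on any
  domain.\<close>

lemma FP_comp2:
  assumes "FP UNIV (\<lambda>z. F (left z) (right z))" "FP D f" "FP D g"
  shows "FP D (\<lambda>x. F (f x) (g x))"
  using FP_comp[OF FP_Node[OF assms(2,3)] assms(1)] by simp

lemma FP_comp3:
  assumes "FP UNIV (\<lambda>z. F (left z) (left (right z)) (right (right z)))" "FP D f" "FP D g" "FP D h"
  shows "FP D (\<lambda>x. F (f x) (g x) (h x))"
  using FP_comp[OF FP_Node[OF assms(2) FP_Node[OF assms(3,4)]] assms(1)] by simp

text \<open>The growth per round does not depend on the accumulator, so over polynomially many
  rounds it adds up to a product of polynomials.\<close>

lemma FP_fold_additive:
  assumes l: "FP D l" and i: "FP D i"
    and "FP UNIV (\<lambda>z. step (left z) (left (right z)) (right (right z)))"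
    and q: "\<And>x y a. size (step x y a) \<le> size a + poly q (size x + size y)"
  shows "FP D (\<lambda>x. fold (step x) (dec_list (l x)) (i x))"
proof -
  obtain pl where pl: "\<And>x. x \<in> D \<Longrightarrow> size (l x) \<le> poly pl (size x)" using FP_size_bound[OF l] by blast
  obtain p where p: "\<And>x. x \<in> D \<Longrightarrow> size (i x) \<le> poly p (size x)" using FP_size_bound[OF i] by blast
  show ?thesis
  proof (rule FP_fold[OF assms(1-3), where q = "p + pl * pcompose q ([:0, 1:] + pl)"])
    fix x ys zs assume x: "x \<in> D" "dec_list (l x) = ys @ zs"
    let ?B = "poly q (size x + poly pl (size x))"
    have "size (fold (step x) ys a) \<le> size a + length ys * ?B" if "set ys \<subseteq> set (dec_list (l x))" for a
      using that
    proof (induction ys arbitrary: a)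
      case (Cons y ys)
      have "size y \<le> poly pl (size x)"
        using Cons.prems size_mem_dec_list[of y "l x"] pl[OF x(1)] by auto
      then have "poly q (size x + size y) \<le> ?B" by (intro poly_nat_mono) simp
      with q[of x y a] have "size (step x y a) \<le> size a + ?B" by linarith
      moreover have "size (fold (step x) ys (step x y a)) \<le> size (step x y a) + length ys * ?B"
        by (rule Cons.IH) (use Cons.prems in simp)
      ultimately show ?case by simp
    qed simp
    then have "size (fold (step x) ys (i x)) \<le> size (i x) + length ys * ?B" using x(2) by simp
    also have "length ys \<le> poly pl (size x)"
      using length_dec_list_le[of "l x"] pl[OF x(1)] x(2) by simp
    finally show "size (fold (step x) ys (i x)) \<le> poly (p + pl * pcompose q ([:0, 1:] + pl)) (size x)"
      using p[OF x(1)] by (simp add: poly_pcompose add_mono)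
  qed simp
qed

lemma size_fold_max:
  assumes "\<And>y a. size (step y a) \<le> max (size a) B"
  shows "size (fold step ys (a :: btree)) \<le> max (size a) B"
proof (induction ys arbitrary: a)
  case (Cons y ys)
  show ?case using Cons.IH[of "step y a"] assms[of y a] by simp
qed simp

text \<open>The accumulator never exceeds the larger of its initial size and a bound given by
  \<open>x\<close> alone, however many rounds there are; this covers iterated closures.\<close>

lemma FP_fold_max:
  assumes l: "FP D l" and i: "FP D i"
    and "FP UNIV (\<lambda>z. step (left z) (left (right z)) (right (right z)))"
    and q: "\<And>x y a. size (step x y a) \<le> max (size a) (poly q (size x))"
  shows "FP D (\<lambda>x. fold (step x) (dec_list (l x)) (i x))"
proof -
  obtain p where p: "\<And>x. x \<in> D \<Longrightarrow> size (i x) \<le> poly p (size x)" using FP_size_bound[OF i] by blast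
  show ?thesis
  proof (rule FP_fold[OF assms(1-3), where q = "p + q"])
    fix x ys zs assume "x \<in> D"
    then show "size (fold (step x) ys (i x)) \<le> poly (p + q) (size x)"
      using size_fold_max[of "step x", OF q, of ys "i x"] p by fastforce
  qed simp
qed

subsection \<open>Booleans\<close>

lemma enc_bool_neq_Leaf [simp]: "enc_bool b \<noteq> Leaf \<longleftrightarrow> b" "enc_bool b = Leaf \<longleftrightarrow> \<not> b"
  by (auto simp: enc_bool_def)

lemma size_enc_bool_le: "size (enc_bool b) \<le> 1"
  by (simp add: enc_bool_def)

lemma FP_True: "FP D (\<lambda>x. enc_bool True)"
  using FP_Node[OF FP_Leaf FP_Leaf] by (simp add: enc_bool_def)

lemma FP_if:
  assumes "FP D (\<lambda>x. enc_bool (P x))" "FP D f" "FP D g"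
  shows "FP D (\<lambda>x. if P x then f x else g x)"
  using FP_If[OF assms(1) FP_subset[OF assms(2)] FP_subset[OF assms(3)]] by auto

lemma FP_neq_Leaf:
  assumes "FP D f"
  shows "FP D (\<lambda>x. enc_bool (f x \<noteq> Leaf))"
  by (rule FP_cong[OF FP_If[OF assms FP_True FP_Leaf]]) (auto simp: enc_bool_def)

lemma FP_not:
  assumes "FP D (\<lambda>x. enc_bool (P x))"
  shows "FP D (\<lambda>x. enc_bool (\<not> P x))"
  by (rule FP_cong[OF FP_if[OF assms FP_Leaf FP_True]]) (auto simp: enc_bool_def)

lemma FP_eq_Leaf: "FP D f \<Longrightarrow> FP D (\<lambda>x. enc_bool (f x = Leaf))"
  using FP_not[OF FP_neq_Leaf] by simp

lemma FP_conj:
  assumes "FP D (\<lambda>x. enc_bool (P x))" "FP D (\<lambda>x. enc_bool (Q x))"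
  shows "FP D (\<lambda>x. enc_bool (P x \<and> Q x))"
  by (rule FP_cong[OF FP_if[OF assms FP_Leaf]]) (auto simp: enc_bool_def)

lemma FP_disj:
  assumes "FP D (\<lambda>x. enc_bool (P x))" "FP D (\<lambda>x. enc_bool (Q x))"
  shows "FP D (\<lambda>x. enc_bool (P x \<or> Q x))"
  by (rule FP_cong[OF FP_if[OF assms(1) FP_True assms(2)]]) (auto simp: enc_bool_def)

lemma FP_iff:
  assumes "FP D (\<lambda>x. enc_bool (P x))" "FP D (\<lambda>x. enc_bool (Q x))"
  shows "FP D (\<lambda>x. enc_bool (P x = Q x))"
  by (rule FP_cong[OF FP_if[OF assms FP_not[OF assms(2)]]]) (auto simp: enc_bool_def)

lemma FP_Bex:
  assumes "FP D l" "FP UNIV (\<lambda>z. enc_bool (P (left z) (right z)))"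
  shows "FP D (\<lambda>x. enc_bool (\<exists>y\<in>set (dec_list (l x)). P x y))"
proof -
  let ?step = "\<lambda>x y a. if P x y then enc_bool True else a"
  have "FP D (\<lambda>x. fold (?step x) (dec_list (l x)) Leaf)"
  proof (rule FP_fold_max[OF assms(1) FP_Leaf, where q = "[:1:]"])
    show "FP UNIV (\<lambda>z. ?step (left z) (left (right z)) (right (right z)))"
      by (intro FP_if FP_comp2[OF assms(2)] FP_left FP_right FP_id FP_True)
  qed (simp add: enc_bool_def)
  moreover have "fold (?step x) ys (enc_bool b) = enc_bool (b \<or> (\<exists>y\<in>set ys. P x y))" for x ys b
  proof (induction ys arbitrary: b)
    case (Cons y ys) then show ?case using Cons.IH[of b] Cons.IH[of True] by auto
  qed simp
  from this[of _ _ False] have "fold (?step x) ys Leaf = enc_bool (\<exists>y\<in>set ys. P x y)" for x ys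
    by (simp add: enc_bool_def)
  ultimately show ?thesis by simp
qed

subsection \<open>Lists\<close>

lemma FP_rev:
  assumes "FP D l"
  shows "FP D (\<lambda>x. enc_list (rev (dec_list (l x))))"
proof -
  have "FP D (\<lambda>x. fold (\<lambda>y a. Node y a) (dec_list (l x)) Leaf)"
    by (rule FP_fold_additive[OF assms FP_Leaf, where q = "[:1, 1:]"])
      (auto intro!: FP_left FP_right FP_id FP_Node)
  moreover have "fold (\<lambda>y a. Node y a) xs (enc_list ys) = enc_list (rev xs @ ys)" for xs ys
  proof (induction xs arbitrary: ys)
    case (Cons x xs) show ?case using Cons.IH[of "x # ys"] by simp
  qed simp
  from this[of _ "[]"] have "fold (\<lambda>y a. Node y a) xs Leaf = enc_list (rev xs)" for xs by simp
  ultimately show ?thesis by simp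
qed

lemma FP_map:
  assumes "FP D l" "FP UNIV (\<lambda>z. f (left z) (right z))"
  shows "FP D (\<lambda>x. enc_list (map (f x) (dec_list (l x))))"
proof -
  obtain p where p: "\<And>z. size (f (left z) (right z)) \<le> poly p (size z)"
  proof (rule FP_size_bound[OF assms(2)])
    fix p assume "\<And>z. z \<in> UNIV \<Longrightarrow> size (f (left z) (right z)) \<le> poly p (size z)"
    then show thesis by (intro that) simp
  qed
  let ?step = "\<lambda>x y a. Node (f x y) a"
  have "FP D (\<lambda>x. fold (?step x) (dec_list (l x)) Leaf)"
  proof (rule FP_fold_additive[OF assms(1) FP_Leaf, where q = "[:1:] + pcompose p [:1, 1:]"])
    show "FP UNIV (\<lambda>z. ?step (left z) (left (right z)) (right (right z)))"
      by (intro FP_Node FP_comp2[OF assms(2)] FP_left FP_right FP_id)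
    show "size (?step x y a) \<le> size a + poly ([:1:] + pcompose p [:1, 1:]) (size x + size y)" for x y a
      using p[of "Node x y"] by (simp add: poly_pcompose)
  qed
  moreover have "fold (?step x) ys (enc_list zs) = enc_list (rev (map (f x) ys) @ zs)" for x ys zs
  proof (induction ys arbitrary: zs)
    case (Cons y ys) show ?case using Cons.IH[of "f x y # zs"] by simp
  qed simp
  from this[of _ _ "[]"] have "fold (?step x) ys Leaf = enc_list (rev (map (f x) ys))" for x ys by simp
  ultimately have "FP D (\<lambda>x. enc_list (rev (map (f x) (dec_list (l x)))))" by simp
  from FP_rev[OF this] show ?thesis by simp
qed

lemma FP_filter:
  assumes "FP D l" "FP UNIV (\<lambda>z. enc_bool (P (left z) (right z)))"
  shows "FP D (\<lambda>x. enc_list (filter (P x) (dec_list (l x))))"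
proof -
  let ?step = "\<lambda>x y a. if P x y then Node y a else a"
  have "FP D (\<lambda>x. fold (?step x) (dec_list (l x)) Leaf)"
  proof (rule FP_fold_additive[OF assms(1) FP_Leaf, where q = "[:1, 1:]"])
    show "FP UNIV (\<lambda>z. ?step (left z) (left (right z)) (right (right z)))"
      by (intro FP_if FP_Node FP_comp2[OF assms(2)] FP_left FP_right FP_id)
  qed simp
  moreover have "fold (?step x) ys (enc_list zs) = enc_list (rev (filter (P x) ys) @ zs)" for x ys zs
  proof (induction ys arbitrary: zs)
    case (Cons y ys) show ?case using Cons.IH[of "y # zs"] Cons.IH[of zs] by simp
  qed simp
  from this[of _ _ "[]"] have "fold (?step x) ys Leaf = enc_list (rev (filter (P x) ys))" for x ys by simp
  ultimately have "FP D (\<lambda>x. enc_list (rev (filter (P x) (dec_list (l x)))))" by simp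
  from FP_rev[OF this] show ?thesis by simp
qed

definition zip_tree :: "btree \<Rightarrow> btree \<Rightarrow> btree" where
  "zip_tree a b = enc_list (map2 Node (dec_list a) (dec_list b))"

lemma FP_zip_tree:
  assumes "FP D f" "FP D g"
  shows "FP D (\<lambda>x. zip_tree (f x) (g x))"
proof -
  \<comment> \<open>The accumulator is a pair: the rest of the second list and the output in
    reverse. With an empty rest the step is idle, which truncates as \<open>zip\<close>
    does.\<close>
  let ?step = "\<lambda>y a. if left a = Leaf then a
    else Node (right (left a)) (Node (Node y (left (left a))) (right a))"
  have "FP D (\<lambda>x. fold ?step (dec_list (f x)) (Node (g x) Leaf))"
  proof (rule FP_fold_additive[where step = "\<lambda>x. ?step" and q = "[:2, 1:]"])
    show "FP UNIV (\<lambda>z. ?step (left (right z)) (right (right z)))"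
      by (intro FP_if FP_Node FP_left FP_right FP_id FP_eq_Leaf)
    show "size (?step y a) \<le> size a + poly [:2, 1:] (size x + size y)" for x y a :: btree
      by (cases a; cases "left a") auto
  qed (intro assms FP_Node FP_Leaf)+
  from FP_rev[OF FP_right[OF this]]
  have "FP D (\<lambda>x. enc_list (rev (dec_list (right (fold ?step (dec_list (f x)) (Node (g x) Leaf))))))" .
  moreover have "right (fold ?step xs (Node (enc_list ys) (enc_list zs))) =
      enc_list (rev (map2 Node xs ys) @ zs)" for xs ys zs
  proof (induction xs arbitrary: ys zs)
    case (Cons x xs)
    have "fold ?step xs (Node Leaf a) = Node Leaf a" for xs a by (induction xs) auto
    then show ?case using Cons.IH[of "tl ys" "Node x (hd ys) # zs"] by (cases ys) auto
  qed simp
  from this[of _ "dec_list _" "[]"] have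
    "right (fold ?step xs (Node t Leaf)) = enc_list (rev (map2 Node xs (dec_list t)))" for xs t
    by simp
  ultimately show ?thesis by (simp add: zip_tree_def)
qed

section \<open>The reduction algorithm on encoded instances\<close>

text \<open>
  A set of vertices is represented by its list of membership bits. There is no equality test, so two
  vertices are compared through their rows of the adjacency matrix, which differ in a tournament.
\<close>

definition same_bits :: "btree \<Rightarrow> btree \<Rightarrow> bool" where
  "same_bits r s \<longleftrightarrow>
    \<not> (\<exists>p\<in>set (dec_list (zip_tree r s)). \<not> ((left p \<noteq> Leaf) = (right p \<noteq> Leaf)))"

text \<open>The row \<open>r\<close> of a vertex is read against the mask \<open>M\<close>. For a
  vertex of a tournament outside the set, a member that is no out-neighbour is an in-neighbour, so
  its row alone decides whether it is mixed.\<close>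

definition mixed_bits :: "btree \<Rightarrow> btree \<Rightarrow> bool" where
  "mixed_bits r M \<longleftrightarrow>
    (\<exists>p\<in>set (dec_list (zip_tree r M)). left p \<noteq> Leaf \<and> right p \<noteq> Leaf) \<and>
    (\<exists>p\<in>set (dec_list (zip_tree r M)). left p = Leaf \<and> right p \<noteq> Leaf)"

definition grow_mask :: "btree \<Rightarrow> btree \<Rightarrow> btree" where
  "grow_mask L M = enc_list (map (\<lambda>p. enc_bool (right p \<noteq> Leaf \<or> mixed_bits (right (left p)) M))
    (dec_list (zip_tree L M)))"

text \<open>The list \<open>L\<close> also acts as a counter: one round per vertex is enough for the
  growth to stop.\<close>

definition close_mask :: "btree \<Rightarrow> btree \<Rightarrow> btree" where
  "close_mask L M = fold (\<lambda>_ M. grow_mask L M) (dec_list L) M"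

definition pair_mask :: "btree \<Rightarrow> btree \<Rightarrow> btree \<Rightarrow> btree" where
  "pair_mask L u v = enc_list (map (\<lambda>e. enc_bool
    (same_bits (right e) (right u) \<or> same_bits (right e) (right v))) (dec_list L))"

definition submask :: "btree \<Rightarrow> btree \<Rightarrow> bool" where
  "submask M X \<longleftrightarrow> \<not> (\<exists>p\<in>set (dec_list (zip_tree M X)). left p \<noteq> Leaf \<and> right p = Leaf)"

definition refine_mask :: "btree \<Rightarrow> btree \<Rightarrow> btree \<Rightarrow> btree \<Rightarrow> btree" where
  "refine_mask L u v X = (if \<not> same_bits (right u) (right v) \<and> submask (pair_mask L u v) X
    then close_mask L (pair_mask L u v) else X)"

definition find_module :: "btree \<Rightarrow> btree" where
  "find_module L = fold (\<lambda>u X. fold (\<lambda>v X. refine_mask L u v X) (dec_list L) X) (dec_list L)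
    (enc_list (map (\<lambda>e. enc_bool True) (dec_list L)))"

text \<open>The intermediate \<open>enc_list\<close> and \<open>dec_list\<close> cancel; they give
  the definition the shape of the closure rules for \<open>map\<close>, \<open>filter\<close> and
  \<open>zip_tree\<close>.\<close>

definition select :: "btree \<Rightarrow> btree \<Rightarrow> btree" where
  "select M l = enc_list (map (\<lambda>p. right p) (dec_list
    (enc_list (filter (\<lambda>p. left p \<noteq> Leaf) (dec_list (zip_tree M l))))))"

definition flip_mask :: "btree \<Rightarrow> btree" where
  "flip_mask M = enc_list (map (\<lambda>e. enc_bool (e = Leaf)) (dec_list M))"

definition sub_instance :: "btree \<Rightarrow> btree \<Rightarrow> btree" where
  "sub_instance X L =
    enc_list (map (\<lambda>e. Node (left e) (select X (right e))) (dec_list (select X L)))"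

text \<open>
  The module \<open>X\<close> is replaced by its first vertex, which moves to the front of the instance and
  receives the weight encoded by \<open>W\<close>.
\<close>

definition contract :: "btree \<Rightarrow> btree \<Rightarrow> btree \<Rightarrow> btree" where
  "contract X W L = enc_list (map
    (\<lambda>e. Node (left e) (Node (left (select X (right e))) (select (flip_mask X) (right e))))
    (dec_list (Node (Node W (right (left (select X L)))) (select (flip_mask X) L))))"

text \<open>For a nonempty encoded instance, \<open>right L\<close> is the list without its first
  vertex, so the test asks for at least two vertices.\<close>

definition contract_step :: "(btree \<Rightarrow> btree) \<Rightarrow> btree \<Rightarrow> btree" where
  "contract_step f L = (if right L \<noteq> Leaf
    then contract (find_module L) (f (sub_instance (find_module L) L)) L else L)"

text \<open>The list that is folded over is again a counter. At the end a single entry is left, and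
  \<open>left (left _)\<close> reads its weight; the empty tournament, with optimum 0, has no entry
  to read.\<close>

definition solve_by_contraction :: "(btree \<Rightarrow> btree) \<Rightarrow> btree \<Rightarrow> btree" where
  "solve_by_contraction f L =
    (if L = Leaf then enc_rat 0 else left (left (fold (\<lambda>_. contract_step f) (dec_list L) L)))"

section \<open>Polynomial time for the steps of the algorithm\<close>

lemma FP_same_bits:
  "FP D f \<Longrightarrow> FP D g \<Longrightarrow> FP D (\<lambda>x. enc_bool (same_bits (f x) (g x)))"
  by (rule FP_comp2[where F = "\<lambda>f g. enc_bool (same_bits f g)"], unfold same_bits_def)
    (intro FP_not FP_Bex FP_zip_tree FP_iff FP_neq_Leaf FP_left FP_right FP_id)+

lemma FP_mixed_bits:
  "FP D f \<Longrightarrow> FP D g \<Longrightarrow> FP D (\<lambda>x. enc_bool (mixed_bits (f x) (g x)))"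
  by (rule FP_comp2[where F = "\<lambda>f g. enc_bool (mixed_bits f g)"], unfold mixed_bits_def)
    (intro FP_conj FP_Bex FP_zip_tree FP_eq_Leaf FP_neq_Leaf FP_left FP_right FP_id)+

lemma FP_submask:
  "FP D f \<Longrightarrow> FP D g \<Longrightarrow> FP D (\<lambda>x. enc_bool (submask (f x) (g x)))"
  by (rule FP_comp2[where F = "\<lambda>f g. enc_bool (submask f g)"], unfold submask_def)
    (intro FP_not FP_conj FP_Bex FP_zip_tree FP_eq_Leaf FP_neq_Leaf FP_left FP_right FP_id)+

lemma FP_grow_mask:
  "FP D f \<Longrightarrow> FP D g \<Longrightarrow> FP D (\<lambda>x. grow_mask (f x) (g x))"
  by (rule FP_comp2[where F = grow_mask], unfold grow_mask_def)
    (intro FP_map FP_disj FP_mixed_bits FP_zip_tree FP_neq_Leaf FP_left FP_right FP_id)+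

lemma size_enc_bool_list: "size (enc_list (map (\<lambda>x. enc_bool (P x)) xs)) \<le> 2 * length xs"
proof (induction xs)
  case (Cons x xs) then show ?case using size_enc_bool_le[of "P x"] by simp
qed simp

text \<open>Each entry of \<open>L\<close> yields one list cell and a bit of size at most 1. The
  bound does not involve \<open>M\<close>, so repeated growing stays small.\<close>

lemma size_grow_mask: "size (grow_mask L M) \<le> 2 * size L"
proof -
  have "length (dec_list (zip_tree L M)) \<le> size L"
    using length_dec_list_le[of L] by (simp add: zip_tree_def min.coboundedI1)
  then show ?thesis unfolding grow_mask_def
    by (intro le_trans[OF size_enc_bool_list]) simp
qed

lemma size_close_mask: "size (close_mask L M) \<le> max (size M) (2 * size L)"
  unfolding close_mask_def by (rule size_fold_max) (simp add: size_grow_mask max.coboundedI2)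

lemma size_pair_mask: "size (pair_mask L u v) \<le> 2 * size L"
  unfolding pair_mask_def
  by (rule le_trans[OF size_enc_bool_list]) (simp add: length_dec_list_le)

lemma size_refine_mask: "size (refine_mask L u v X) \<le> max (size X) (2 * size L)"
proof (cases "\<not> same_bits (right u) (right v) \<and> submask (pair_mask L u v) X")
  case True
  then have "refine_mask L u v X = close_mask L (pair_mask L u v)" by (simp add: refine_mask_def)
  then show ?thesis using size_close_mask[of L "pair_mask L u v"] size_pair_mask[of L u v] by simp
next
  case False
  then have "refine_mask L u v X = X" by (auto simp: refine_mask_def)
  then show ?thesis by simp
qed

lemma FP_close_mask:
  "FP D f \<Longrightarrow> FP D g \<Longrightarrow> FP D (\<lambda>x. close_mask (f x) (g x))"
proof (rule FP_comp2[where F = close_mask])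
  show "FP UNIV (\<lambda>z. close_mask (left z) (right z))"
    unfolding close_mask_def
  proof (rule FP_fold_max[where step = "\<lambda>z _ M. grow_mask (left z) M" and q = "[:0, 2:]"])
    show "size (grow_mask (left x) a) \<le> max (size a) (poly [:0, 2:] (size x))" for x a
      using size_grow_mask[of "left x" a] size_left_le[of x] by simp
  qed (intro FP_grow_mask FP_left FP_right FP_id)+
qed

lemma FP_pair_mask:
  "FP D f \<Longrightarrow> FP D g \<Longrightarrow> FP D h \<Longrightarrow> FP D (\<lambda>x. pair_mask (f x) (g x) (h x))"
  by (rule FP_comp3[where F = pair_mask], unfold pair_mask_def)
    (intro FP_map FP_disj FP_same_bits FP_left FP_right FP_id)+

lemma FP_refine_mask:
  "FP D f \<Longrightarrow> FP D g \<Longrightarrow> FP D h \<Longrightarrow> FP D k \<Longrightarrow> FP D (\<lambda>x. refine_mask (f x) (g x) (h x) (k x))"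
  unfolding refine_mask_def
  by (intro FP_if FP_not FP_conj FP_same_bits FP_submask FP_pair_mask FP_close_mask FP_right)

lemma FP_find_module:
  assumes "FP D f"
  shows "FP D (\<lambda>x. find_module (f x))"
proof -
  have "FP UNIV find_module"
    unfolding find_module_def
  proof (rule FP_fold_max[where step = "\<lambda>L u X. fold (\<lambda>v X. refine_mask L u v X) (dec_list L) X"
        and q = "[:0, 2:]"])
    show "FP UNIV (\<lambda>z. fold (\<lambda>v X. refine_mask (left z) (left (right z)) v X) (dec_list (left z))
      (right (right z)))"
    proof (rule FP_fold_max[where step = "\<lambda>z v X. refine_mask (left z) (left (right z)) v X"
          and q = "[:0, 2:]"])
      show "size (refine_mask (left x) (left (right x)) y a) \<le> max (size a) (poly [:0, 2:] (size x))"
        for x y a using size_refine_mask[of "left x" "left (right x)" y a] size_left_le[of x] by simp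
    qed (intro FP_refine_mask FP_left FP_right FP_id)+
    show "size (fold (\<lambda>v X. refine_mask x y v X) (dec_list x) a) \<le> max (size a) (poly [:0, 2:] (size x))"
      for x y a using size_fold_max[of "refine_mask x y", OF size_refine_mask] by (simp add: mult.commute)
  qed (intro FP_map FP_True FP_id)+
  from FP_comp[OF assms this] show ?thesis by simp
qed

lemma FP_select: "FP D f \<Longrightarrow> FP D g \<Longrightarrow> FP D (\<lambda>x. select (f x) (g x))"
  by (rule FP_comp2[where F = select], unfold select_def)
    (intro FP_map FP_filter FP_zip_tree FP_neq_Leaf FP_left FP_right FP_id)+

lemma FP_flip_mask: "FP D f \<Longrightarrow> FP D (\<lambda>x. flip_mask (f x))"
  unfolding flip_mask_def by (intro FP_map FP_eq_Leaf FP_left FP_right FP_id)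

lemma FP_sub_instance: "FP D f \<Longrightarrow> FP D g \<Longrightarrow> FP D (\<lambda>x. sub_instance (f x) (g x))"
  by (rule FP_comp2[where F = sub_instance], unfold sub_instance_def)
    (intro FP_map FP_Node FP_select FP_left FP_right FP_id)+

lemma FP_contract:
  "FP D f \<Longrightarrow> FP D g \<Longrightarrow> FP D h \<Longrightarrow> FP D (\<lambda>x. contract (f x) (g x) (h x))"
  by (rule FP_comp3[where F = contract], unfold contract_def)
    (intro FP_map FP_Node FP_select FP_flip_mask FP_left FP_right FP_id)+

text \<open>The solver is called only behind the test for two vertices, so \<open>E\<close> has to
  contain only the module instances arising there.\<close>

lemma FP_contract_step:
  assumes "FP E f" "\<And>L. L \<in> D \<Longrightarrow> right L \<noteq> Leaf \<Longrightarrow> sub_instance (find_module L) L \<in> E"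
  shows "FP D (contract_step f)"
proof -
  have "FP {L \<in> D. right L \<noteq> Leaf} (\<lambda>L. f (sub_instance (find_module L) L))"
    by (rule FP_comp[OF FP_sub_instance[OF FP_find_module[OF FP_id] FP_id] assms(1)])
      (use assms(2) in auto)
  from FP_If[OF FP_right[OF FP_id] FP_contract[OF FP_find_module[OF FP_id] this FP_id] FP_id]
  show ?thesis unfolding contract_step_def .
qed

lemma FP_enc_rat_0: "FP D (\<lambda>x. enc_rat 0)"
  unfolding enc_rat_def by (simp add: enc_nat.simps enc_bool_def) (intro FP_Node FP_Leaf)

text \<open>Both invariants speak of folds over prefixes: each round needs an admissible input of
  polynomial size, and a bound on the final result would not give this.\<close>

lemma FP_solve_by_contraction:
  assumes "FP E (contract_step f)"
    and "\<And>L ys y zs. L \<in> D \<Longrightarrow> dec_list L = ys @ y # zs \<Longrightarrow> fold (\<lambda>_. contract_step f) ys L \<in> E"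
    and "\<And>L ys zs. L \<in> D \<Longrightarrow> dec_list L = ys @ zs \<Longrightarrow>
      size (fold (\<lambda>_. contract_step f) ys L) \<le> poly q (size L)"
  shows "FP D (solve_by_contraction f)"
proof -
  have "FP {z. right (right z) \<in> E} (\<lambda>z. contract_step f (right (right z)))"
    by (rule FP_comp[OF FP_right[OF FP_right[OF FP_id]] assms(1)]) simp
  then have "FP D (\<lambda>L. fold (\<lambda>_. contract_step f) (dec_list L) L)"
    by (rule FP_fold[OF FP_id FP_id, where step = "\<lambda>x _. contract_step f" and q = q])
      (use assms(2,3) in auto)
  then show ?thesis
    unfolding solve_by_contraction_def by (intro FP_if FP_eq_Leaf FP_id FP_enc_rat_0 FP_left)
qed

section \<open>Homogeneous sets\<close>

lemma arcs_ends_induce: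
  "arcs_ends (G \<restriction> X) = {(u, v) \<in> arcs_ends G. u \<in> X \<and> v \<in> X}"
  by (auto simp: arcs_ends_def arc_to_ends_def)

context tournament
begin

lemma arcs_ends_in_verts: "(u, v) \<in> arcs_ends G \<Longrightarrow> u \<in> verts G \<and> v \<in> verts G"
  by (auto simp: arcs_ends_def arc_to_ends_def)

lemma arcs_ends_irrefl: "(u, u) \<notin> arcs_ends G"
  using no_loops by (auto simp: arcs_ends_def arc_to_ends_def)

lemma arcs_ends_asym: "(u, v) \<in> arcs_ends G \<Longrightarrow> (v, u) \<notin> arcs_ends G"
  using one_arc arcs_ends_in_verts arcs_ends_irrefl by metis

lemma tournament_induce:
  assumes "X \<subseteq> verts G"
  shows "tournament (G \<restriction> X)"
proof
  fix e assume "e \<in> arcs (G \<restriction> X)"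
  then show "tail (G \<restriction> X) e \<in> verts (G \<restriction> X)" "head (G \<restriction> X) e \<in> verts (G \<restriction> X)"
    "tail (G \<restriction> X) e \<noteq> head (G \<restriction> X) e" using no_loops by auto
next
  show "finite (verts (G \<restriction> X))" "finite (arcs (G \<restriction> X))"
    using assms finite_subset[OF assms finite_verts] by auto
next
  fix e1 e2 assume "e1 \<in> arcs (G \<restriction> X)" "e2 \<in> arcs (G \<restriction> X)"
    "arc_to_ends (G \<restriction> X) e1 = arc_to_ends (G \<restriction> X) e2"
  then show "e1 = e2" using no_multi_arcs by (auto simp: arc_to_ends_def)
next
  fix u v assume "u \<in> verts (G \<restriction> X)" "v \<in> verts (G \<restriction> X)" "u \<noteq> v"
  then show "(u, v) \<in> arcs_ends (G \<restriction> X) \<longleftrightarrow> (v, u) \<notin> arcs_ends (G \<restriction> X)"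
    using one_arc[of u v] assms by (auto simp: arcs_ends_induce)
qed

lemma is_free_of_induce:
  assumes "X \<subseteq> verts G" "is_free_of G H"
  shows "is_free_of (G \<restriction> X) H"
proof -
  have "induced_subgraph K G" if K: "induced_subgraph K (G \<restriction> X)" for K
  proof (rule induced_subgraphI)
    show "subgraph K G"
    proof (rule subgraph_trans)
      show "subgraph K (G \<restriction> X)" using K by blast
      show "subgraph (G \<restriction> X) G" using induced_induce[OF assms(1)] by blast
    qed
    have "verts K \<subseteq> X" "arcs K = {e \<in> arcs (G \<restriction> X). tail G e \<in> verts K \<and> head G e \<in> verts K}"
      using K by (auto simp: induced_subgraph_def subgraph_def)
    then show "arcs K = {e \<in> arcs G. tail G e \<in> verts K \<and> head G e \<in> verts K}"
      by auto
  qed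
  with assms(2) show ?thesis unfolding is_free_of_def by blast
qed

lemma homogeneous_iff:
  assumes "homogeneous G X" "a \<in> X" "b \<in> X" "c \<in> verts G - X"
  shows "(a, c) \<in> arcs_ends G \<longleftrightarrow> (b, c) \<in> arcs_ends G"
    and "(c, a) \<in> arcs_ends G \<longleftrightarrow> (c, b) \<in> arcs_ends G"
  using assms arcs_ends_asym unfolding homogeneous_def by blast+

section \<open>Closing a vertex set under mixed vertices\<close>

definition grow_set :: "'a set \<Rightarrow> 'a set" where
  "grow_set A = A \<union> {z \<in> verts G. (\<exists>x\<in>A. (z, x) \<in> arcs_ends G) \<and> (\<exists>x\<in>A. (z, x) \<notin> arcs_ends G)}"

definition close_set :: "'a set \<Rightarrow> 'a set" where
  "close_set A = (grow_set ^^ card (verts G)) A"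

lemma subset_grow_set: "A \<subseteq> grow_set A"
  by (auto simp: grow_set_def)

text \<open>A vertex outside the homogeneous set \<open>Y\<close> is not mixed on \<open>Y\<close>,
  hence not on any subset.\<close>

lemma grow_set_subset_homogeneous:
  assumes "homogeneous G Y" "A \<subseteq> Y"
  shows "grow_set A \<subseteq> Y"
proof
  fix z assume z: "z \<in> grow_set A"
  show "z \<in> Y"
  proof (rule ccontr)
    assume "z \<notin> Y"
    with z assms(2) obtain x y where "z \<in> verts G - Y" "x \<in> Y" "y \<in> Y"
      "(z, x) \<in> arcs_ends G" "(z, y) \<notin> arcs_ends G" by (auto simp: grow_set_def)
    then show False using homogeneous_iff(2)[OF assms(1)] by blast
  qed
qed

lemma homogeneous_if_grow_set_fixed:
  assumes "A \<subseteq> verts G" "grow_set A = A"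
  shows "homogeneous G A"
  unfolding homogeneous_def
proof (intro conjI ballI assms)
  fix z assume z: "z \<in> verts G - A"
  then have "z \<notin> grow_set A" using assms(2) by simp
  then have "(\<forall>x\<in>A. (z, x) \<in> arcs_ends G) \<or> (\<forall>x\<in>A. (z, x) \<notin> arcs_ends G)"
    using z unfolding grow_set_def by blast
  moreover have "(x, z) \<in> arcs_ends G" if "x \<in> A" "(z, x) \<notin> arcs_ends G" for x
    using one_arc[of x z] that z assms(1) by blast
  ultimately show "(\<forall>x\<in>A. (z, x) \<in> arcs_ends G) \<or> (\<forall>x\<in>A. (x, z) \<in> arcs_ends G)" by blast
qed

lemma funpow_grow_set_subset_homogeneous:
  "homogeneous G Y \<Longrightarrow> A \<subseteq> Y \<Longrightarrow> (grow_set ^^ n) A \<subseteq> Y"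
  by (induction n) (auto dest: grow_set_subset_homogeneous)

lemma homogeneous_verts: "homogeneous G (verts G)"
  by (simp add: homogeneous_def)

lemma subset_funpow_grow_set: "A \<subseteq> (grow_set ^^ n) A"
  by (induction n) (use subset_grow_set in auto)

lemma close_set_minimal: "homogeneous G Y \<Longrightarrow> A \<subseteq> Y \<Longrightarrow> close_set A \<subseteq> Y"
  unfolding close_set_def by (rule funpow_grow_set_subset_homogeneous)

lemma subset_close_set: "A \<subseteq> close_set A"
  unfolding close_set_def by (rule subset_funpow_grow_set)

lemma homogeneous_close_set:
  assumes A: "A \<subseteq> verts G"
  shows "homogeneous G (close_set A)"
proof -
  define g where "g n = (grow_set ^^ n) A" for n
  have g_Suc: "g (Suc n) = grow_set (g n)" and g_0: "g 0 = A" for n by (simp_all add: g_def)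
  have V: "g n \<subseteq> verts G" for n
    unfolding g_def using funpow_grow_set_subset_homogeneous[OF homogeneous_verts A] .
  \<comment> \<open>A chain that is not yet stationary has gained a vertex in every round, and a
    nonempty \<open>g 1\<close> provides the first one. At \<open>n = card (verts G)\<close> the
    second alternative is impossible.\<close>
  have *: "g (Suc n) = g n \<or> n < card (g (Suc n))" for n
  proof (induction n)
    case 0
    show ?case
    proof (cases "g 1 = {}")
      case False
      then have "0 < card (g 1)" using V[of 1] by (simp add: card_gt_0_iff finite_subset)
      then show ?thesis by simp
    qed (use subset_grow_set[of A] g_Suc[of 0] g_0 in auto)
  next
    case (Suc n)
    show ?case
    proof (cases "g (Suc (Suc n)) = g (Suc n)")
      case False
      then have "g (Suc n) \<noteq> g n" by (metis g_Suc)
      with Suc have "n < card (g (Suc n))" by blast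
      moreover have "g (Suc n) \<subset> g (Suc (Suc n))" using False subset_grow_set[of "g (Suc n)"] g_Suc by auto
      then have "card (g (Suc n)) < card (g (Suc (Suc n)))"
        using V[of "Suc (Suc n)"] by (intro psubset_card_mono) (auto intro: finite_subset)
      ultimately show ?thesis by linarith
    qed simp
  qed
  have "card (g (Suc (card (verts G)))) \<le> card (verts G)"
    using V by (intro card_mono) auto
  with *[of "card (verts G)"] have "g (Suc (card (verts G))) = g (card (verts G))" by linarith
  then show ?thesis unfolding close_set_def g_def[symmetric]
    by (intro homogeneous_if_grow_set_fixed V) (simp add: g_Suc)
qed

section \<open>Minimal homogeneous sets with two vertices\<close>

definition refine_set :: "'a \<Rightarrow> 'a \<Rightarrow> 'a set \<Rightarrow> 'a set" where
  "refine_set u v X = (if u \<noteq> v \<and> {u, v} \<subseteq> X then close_set {u, v} else X)"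

text \<open>A homogeneous set contains the closure of any two of its vertices, so the last clause
  says that no proper subset of \<open>X\<close> with two vertices is homogeneous.\<close>

definition minimal_module :: "'a set \<Rightarrow> bool" where
  "minimal_module X \<longleftrightarrow> homogeneous G X \<and> (\<exists>u\<in>X. \<exists>v\<in>X. u \<noteq> v) \<and>
    (\<forall>u\<in>X. \<forall>v\<in>X. u \<noteq> v \<longrightarrow> X \<subseteq> close_set {u, v})"

text \<open>
  One pass over all pairs suffices: a pair that survives in the final set was contained in every
  earlier one, so the set was replaced by its closure when the pair was met.
\<close>

lemma minimal_module_fold_refine_set:
  assumes "set xs = verts G" "\<exists>u\<in>verts G. \<exists>v\<in>verts G. u \<noteq> v"
  shows "minimal_module (fold (\<lambda>u X. fold (\<lambda>v X. refine_set u v X) xs X) xs (verts G))"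
proof -
  let ?F = "\<lambda>ps. fold (\<lambda>(u, v). refine_set u v) ps (verts G)"
  \<comment> \<open>Each pair already treated that still lies in the current set generates all of
    it. Shrinking the set preserves this clause, so only the newest pair needs attention.\<close>
  have "homogeneous G (?F ps) \<and> (\<exists>u\<in>?F ps. \<exists>v\<in>?F ps. u \<noteq> v) \<and>
    (\<forall>(u, v)\<in>set ps. u \<in> ?F ps \<longrightarrow> v \<in> ?F ps \<longrightarrow> u \<noteq> v \<longrightarrow> ?F ps \<subseteq> close_set {u, v})" for ps
  proof (induction ps rule: rev_induct)
    case Nil then show ?case using assms(2) homogeneous_verts by simp
  next
    case (snoc p ps)
    obtain a b where p: "p = (a, b)" by (cases p)
    let ?X = "?F ps"
    have X: "?X \<subseteq> verts G" using snoc by (auto simp: homogeneous_def)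
    show ?case
    proof (cases "a \<noteq> b \<and> {a, b} \<subseteq> ?X")
      case True
      then have F: "?F (ps @ [p]) = close_set {a, b}" by (simp add: p refine_set_def)
      have sub: "close_set {a, b} \<subseteq> ?X" using snoc True by (intro close_set_minimal) auto
      have "a \<in> close_set {a, b}" "b \<in> close_set {a, b}" using subset_close_set[of "{a, b}"] by auto
      moreover have "homogeneous G (close_set {a, b})" using X True by (intro homogeneous_close_set) auto
      moreover have "close_set {a, b} \<subseteq> close_set {u, v}"
        if "(u, v) \<in> set (ps @ [p])" "u \<in> close_set {a, b}" "v \<in> close_set {a, b}" "u \<noteq> v" for u v
      proof (cases "(u, v) \<in> set ps")
        case True
        have "u \<in> ?X" "v \<in> ?X" using that(2,3) sub by blast+
        with snoc True that(4) have "?X \<subseteq> close_set {u, v}" by blast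
        with sub show ?thesis by (rule subset_trans)
      qed (use that(1) p in simp)
      ultimately show ?thesis unfolding F using True by blast
    next
      case False
      then have F: "?F (ps @ [p]) = ?X" by (auto simp: p refine_set_def)
      have "(u, v) \<in> set ps"
        if "(u, v) \<in> set (ps @ [p])" "u \<in> ?X" "v \<in> ?X" "u \<noteq> v" for u v
        using that False p by auto
      with snoc show ?thesis unfolding F by blast
    qed
  qed
  from this[of "List.product xs xs"]
  have "minimal_module (?F (List.product xs xs))"
    unfolding minimal_module_def
  proof (elim conjE, intro conjI ballI impI)
    fix u v assume *: "homogeneous G (?F (List.product xs xs))"
      "\<forall>(u, v)\<in>set (List.product xs xs). u \<in> ?F (List.product xs xs) \<longrightarrow>
        v \<in> ?F (List.product xs xs) \<longrightarrow> u \<noteq> v \<longrightarrow> ?F (List.product xs xs) \<subseteq> close_set {u, v}"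
      and uv: "u \<in> ?F (List.product xs xs)" "v \<in> ?F (List.product xs xs)" "u \<noteq> v"
    have "(u, v) \<in> set (List.product xs xs)"
      using uv *(1) assms(1) unfolding homogeneous_def by auto
    with *(2) uv show "?F (List.product xs xs) \<subseteq> close_set {u, v}" by blast
  qed
  moreover have "fold (\<lambda>u X. fold (\<lambda>v X. refine_set u v X) xs X) ys X =
    fold (\<lambda>(u, v). refine_set u v) (List.product ys xs) X" for ys X
    by (induction ys arbitrary: X) (auto simp: fold_map comp_def)
  ultimately show ?thesis by simp
qed

lemma homogeneous_trans:
  assumes "homogeneous G X" "homogeneous (G \<restriction> X) Y"
  shows "homogeneous G Y"
  unfolding homogeneous_def
proof (intro conjI ballI)
  have YX: "Y \<subseteq> X" using assms(2) by (simp add: homogeneous_def)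
  then show "Y \<subseteq> verts G" using assms(1) by (auto simp: homogeneous_def)
  fix v assume v: "v \<in> verts G - Y"
  show "(\<forall>x\<in>Y. (v, x) \<in> arcs_ends G) \<or> (\<forall>x\<in>Y. (x, v) \<in> arcs_ends G)"
  proof (cases "v \<in> X")
    case True then show ?thesis using assms(2) v by (fastforce simp: homogeneous_def arcs_ends_induce)
  next
    case False then show ?thesis using assms(1) v YX by (fastforce simp: homogeneous_def)
  qed
qed

text \<open>A homogeneous set \<open>Y\<close> of \<open>G \<restriction> X\<close> is homogeneous
  in \<open>G\<close> as well, so it contains the closure, taken in \<open>G\<close>, of any two of
  its vertices; minimality then forces \<open>Y = X\<close>.\<close>

lemma prime_minimal_module:
  assumes "minimal_module X"
  shows "prime_tournament (G \<restriction> X)"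
  unfolding prime_tournament_def
proof (intro conjI allI impI)
  have X: "homogeneous G X" "X \<subseteq> verts G" using assms by (auto simp: minimal_module_def homogeneous_def)
  then show "tournament (G \<restriction> X)" by (intro tournament_induce)
  fix Y assume Y: "homogeneous (G \<restriction> X) Y"
  have YX: "Y \<subseteq> X" using Y by (simp add: homogeneous_def)
  show "trivial_homogeneous (G \<restriction> X) Y"
  proof (cases "\<exists>u\<in>Y. \<exists>v\<in>Y. u \<noteq> v")
    case True
    then obtain u v where uv: "u \<in> Y" "v \<in> Y" "u \<noteq> v" by blast
    have "X \<subseteq> close_set {u, v}" using assms uv YX unfolding minimal_module_def by blast
    also have "\<dots> \<subseteq> Y" using uv by (intro close_set_minimal homogeneous_trans[OF X(1) Y]) auto
    finally show ?thesis using YX by (simp add: trivial_homogeneous_def)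
  next
    case False
    then have "Y = {} \<or> (\<exists>y. Y = {y})" by blast
    then have "card Y \<le> 1" by auto
    then show ?thesis by (simp add: trivial_homogeneous_def)
  qed
qed

section \<open>Contracting a homogeneous set\<close>

lemma independent_set_iff:
  "independent_set G S \<longleftrightarrow> S \<subseteq> verts G \<and> (\<forall>a\<in>S. \<forall>b\<in>S. \<forall>c\<in>S.
    (a, b) \<in> arcs_ends G \<longrightarrow> (b, c) \<in> arcs_ends G \<longrightarrow> (a, c) \<in> arcs_ends G)"
  unfolding independent_set_def arcs_ends_induce trans_def by blast

lemma independent_set_induce_iff:
  assumes "X \<subseteq> verts G"
  shows "independent_set (G \<restriction> X) S \<longleftrightarrow> S \<subseteq> X \<and> independent_set G S"
proof -
  have "arcs_ends ((G \<restriction> X) \<restriction> S) = arcs_ends (G \<restriction> S)" if "S \<subseteq> X"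
    using that unfolding arcs_ends_induce by blast
  then show ?thesis using assms unfolding independent_set_def induce_subgraph_verts by auto
qed

lemma finite_independent_weights: "finite {\<Sum>v\<in>S. (w v :: rat) | S. independent_set G S}"
proof -
  have "{\<Sum>v\<in>S. w v | S. independent_set G S} \<subseteq> sum w ` Pow (verts G)"
    by (auto simp: independent_set_def)
  then show ?thesis by (rule finite_subset) simp
qed

lemma max_independent_weight_ge:
  "independent_set G S \<Longrightarrow> sum w S \<le> max_independent_weight G w"
  unfolding max_independent_weight_def by (rule Max_ge[OF finite_independent_weights]) auto

lemma max_independent_weight_attained:
  obtains S where "independent_set G S" "sum w S = max_independent_weight G w"
proof -
  have "independent_set G {}" by (simp add: independent_set_iff)
  then have "{\<Sum>v\<in>S. w v | S. independent_set G S} \<noteq> {}" by blast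
  from Max_in[OF finite_independent_weights this] show thesis
    using that unfolding max_independent_weight_def by auto
qed

text \<open>Vertices outside \<open>X\<close> cannot distinguish its members. In an independent set
  of the contracted tournament, \<open>x\<close> can be replaced by an optimal set of
  \<open>X\<close>; conversely, a nonempty part inside \<open>X\<close> can be replaced by
  \<open>x\<close>, whose new weight is at least the weight of that part.\<close>

lemma max_independent_weight_contract:
  fixes w :: "'a \<Rightarrow> rat"
  assumes X: "homogeneous G X" and x: "x \<in> X"
  defines "Y \<equiv> insert x (verts G - X)" and "w' \<equiv> w(x := max_independent_weight (G \<restriction> X) w)"
  shows "max_independent_weight (G \<restriction> Y) w' = max_independent_weight G w"
proof (rule antisym)
  have XV: "X \<subseteq> verts G" using X by (simp add: homogeneous_def)
  have YV: "Y \<subseteq> verts G" using XV x by (auto simp: Y_def)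
  interpret GX: tournament "G \<restriction> X" using XV by (rule tournament_induce)
  interpret GY: tournament "G \<restriction> Y" using YV by (rule tournament_induce)
  note iff = homogeneous_iff[OF X]
  show "max_independent_weight (G \<restriction> Y) w' \<le> max_independent_weight G w"
  proof -
    obtain S where S: "independent_set (G \<restriction> Y) S" "sum w' S = max_independent_weight (G \<restriction> Y) w'"
      by (rule GY.max_independent_weight_attained)
    have SY: "S \<subseteq> Y" "independent_set G S" using S(1) independent_set_induce_iff[OF YV] by auto
    have finS: "finite S" using SY(1) YV by (meson finite_subset finite_verts)
    show ?thesis
    proof (cases "x \<in> S")
      case False
      then have "sum w' S = sum w S" by (intro sum.cong) (auto simp: w'_def)
      then show ?thesis using max_independent_weight_ge[OF SY(2), of w] S(2) by simp
    next
      case True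
      obtain T where T: "independent_set (G \<restriction> X) T" "sum w T = max_independent_weight (G \<restriction> X) w"
        by (rule GX.max_independent_weight_attained)
      have TX: "T \<subseteq> X" "independent_set G T" using T(1) independent_set_induce_iff[OF XV] by auto
      have finT: "finite T" using TX(1) XV by (meson finite_subset finite_verts)
      let ?R = "(S - {x}) \<union> T"
      have out: "a \<in> verts G - X" if "a \<in> S - {x}" for a using that SY(1) by (auto simp: Y_def)
      have "independent_set G ?R"
        unfolding independent_set_iff
      proof (intro conjI ballI impI)
        show "?R \<subseteq> verts G" using SY YV TX XV by auto
        fix a b c assume abc: "a \<in> ?R" "b \<in> ?R" "c \<in> ?R"
          and ab: "(a, b) \<in> arcs_ends G" and bc: "(b, c) \<in> arcs_ends G"
        have S_trans: "(p, r) \<in> arcs_ends G"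
          if "p \<in> S" "q \<in> S" "r \<in> S" "(p, q) \<in> arcs_ends G" "(q, r) \<in> arcs_ends G" for p q r
          using SY(2) that unfolding independent_set_iff by blast
        have T_trans: "(p, r) \<in> arcs_ends G"
          if "p \<in> T" "q \<in> T" "r \<in> T" "(p, q) \<in> arcs_ends G" "(q, r) \<in> arcs_ends G" for p q r
          using TX(2) that unfolding independent_set_iff by blast
        have mem: "(p \<in> T \<and> p \<in> X) \<or> (p \<in> S \<and> p \<in> verts G - X)" if "p \<in> ?R" for p
          using that out TX(1) by blast
        \<comment> \<open>The cases record which of the three vertices lie in \<open>X\<close>. A
          single one is exchanged for \<open>x\<close>, so that transitivity in \<open>S\<close>
          applies; two of them are treated alike by the third, so the pattern inside, outside,
          inside cannot be a path.\<close>
        consider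
          "a \<in> T" "b \<in> T" "c \<in> T" | "a \<in> X" "b \<in> X" "c \<in> verts G - X"
          | "a \<in> verts G - X" "b \<in> X" "c \<in> X" | "a \<in> X" "b \<in> verts G - X" "c \<in> X"
          | "a \<in> X" "b \<in> S" "b \<in> verts G - X" "c \<in> S" "c \<in> verts G - X"
          | "b \<in> X" "a \<in> S" "a \<in> verts G - X" "c \<in> S" "c \<in> verts G - X"
          | "c \<in> X" "a \<in> S" "a \<in> verts G - X" "b \<in> S" "b \<in> verts G - X"
          | "a \<in> S" "b \<in> S" "c \<in> S"
          using mem[OF abc(1)] mem[OF abc(2)] mem[OF abc(3)] by satx
        then show "(a, c) \<in> arcs_ends G"
        proof cases
          case 1 then show ?thesis using T_trans ab bc by blast
        next
          case 2 then show ?thesis using iff(1) bc by blast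
        next
          case 3 then show ?thesis using iff(2) ab by blast
        next
          case 4 then show ?thesis using iff(1) ab bc arcs_ends_asym by blast
        next
          case 5
          then have "(x, b) \<in> arcs_ends G" using iff(1) ab x by blast
          then have "(x, c) \<in> arcs_ends G" using S_trans[of x b c] True 5 bc by blast
          then show ?thesis using iff(1) 5 x by blast
        next
          case 6
          then have "(a, x) \<in> arcs_ends G" "(x, c) \<in> arcs_ends G" using iff ab bc x by blast+
          then show ?thesis using S_trans[of a x c] True 6 by blast
        next
          case 7
          then have "(b, x) \<in> arcs_ends G" using iff(2) bc x by blast
          then have "(a, x) \<in> arcs_ends G" using S_trans[of a b x] True 7 ab by blast
          then show ?thesis using iff(2) 7 x by blast
        next
          case 8 then show ?thesis using S_trans ab bc by blast
        qed
      qed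
      from max_independent_weight_ge[OF this, of w]
      have "sum w (S - {x}) + sum w T \<le> max_independent_weight G w"
        using out TX(1) finS finT by (subst (asm) sum.union_disjoint) auto
      moreover have "sum w' S = w' x + sum w' (S - {x})" using True finS by (simp add: sum.remove)
      moreover have "sum w' (S - {x}) = sum w (S - {x})" by (intro sum.cong) (auto simp: w'_def)
      ultimately show ?thesis using S(2) T(2) by (simp add: w'_def)
    qed
  qed
  show "max_independent_weight G w \<le> max_independent_weight (G \<restriction> Y) w'"
  proof -
    obtain S where S: "independent_set G S" "sum w S = max_independent_weight G w"
      by (rule max_independent_weight_attained)
    have SV: "S \<subseteq> verts G" using S(1) by (simp add: independent_set_def)
    have finS: "finite S" using SV by (auto intro: finite_subset)
    show ?thesis
    proof (cases "S \<inter> X = {}")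
      case True
      then have "sum w' S = sum w S" using x by (intro sum.cong) (auto simp: w'_def)
      moreover have "independent_set (G \<restriction> Y) S"
        using True S(1) SV independent_set_induce_iff[OF YV] by (auto simp: Y_def)
      ultimately show ?thesis using GY.max_independent_weight_ge[of S w'] S(2) by simp
    next
      case False
      then obtain s where s: "s \<in> S" "s \<in> X" by blast
      \<comment> \<open>Sending \<open>x\<close> to a vertex \<open>s\<close> of the part inside
        \<open>X\<close> maps \<open>?R\<close> into \<open>S\<close> and preserves arcs and
        non-arcs, so transitivity carries over.\<close>
      let ?R = "insert x (S - X)" and ?\<psi> = "\<lambda>a. if a = x then s else a"
      have \<psi>: "(a, b) \<in> arcs_ends G \<longleftrightarrow> (?\<psi> a, ?\<psi> b) \<in> arcs_ends G" if "a \<in> ?R" "b \<in> ?R" for a b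
        using that s x iff[OF x s(2)] SV arcs_ends_irrefl by auto
      have \<psi>S: "?\<psi> a \<in> S" if "a \<in> ?R" for a using that s by auto
      have "independent_set G ?R"
        unfolding independent_set_iff
      proof (intro conjI ballI impI)
        show "?R \<subseteq> verts G" using SV x XV by auto
        fix a b c assume abc: "a \<in> ?R" "b \<in> ?R" "c \<in> ?R"
          "(a, b) \<in> arcs_ends G" "(b, c) \<in> arcs_ends G"
        then have "(?\<psi> a, ?\<psi> b) \<in> arcs_ends G" "(?\<psi> b, ?\<psi> c) \<in> arcs_ends G" using \<psi> by blast+
        then have "(?\<psi> a, ?\<psi> c) \<in> arcs_ends G"
          using S(1) \<psi>S abc(1-3) unfolding independent_set_iff by blast
        then show "(a, c) \<in> arcs_ends G" using \<psi> abc by blast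
      qed
      then have "independent_set (G \<restriction> Y) ?R"
        using independent_set_induce_iff[OF YV] SV by (auto simp: Y_def)
      then have "sum w' ?R \<le> max_independent_weight (G \<restriction> Y) w'"
        by (rule GY.max_independent_weight_ge)
      moreover have "sum w' ?R = w' x + sum w' (S - X)" using finS x by simp
      moreover have "sum w' (S - X) = sum w (S - X)" using x by (intro sum.cong) (auto simp: w'_def)
      moreover have "sum w S = sum w (S \<inter> X) + sum w (S - X)"
        using finS sum.Int_Diff by blast
      moreover have "independent_set (G \<restriction> X) (S \<inter> X)"
        using S(1) unfolding independent_set_induce_iff[OF XV] independent_set_iff by blast
      then have "sum w (S \<inter> X) \<le> w' x" using GX.max_independent_weight_ge by (simp add: w'_def)
      ultimately show ?thesis using S(2) by simp
    qed
  qed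
qed

end

section \<open>Correctness of the algorithm on encodings\<close>

lemma enc_list_inject [simp]: "enc_list xs = enc_list ys \<longleftrightarrow> xs = ys"
  by (metis dec_enc_list)

lemma enc_bool_inject [simp]: "enc_bool a = enc_bool b \<longleftrightarrow> a = b"
  by (simp add: enc_bool_def)

definition bits :: "'v list \<Rightarrow> ('v \<Rightarrow> bool) \<Rightarrow> btree" where
  "bits xs P = enc_list (map (\<lambda>v. enc_bool (P v)) xs)"

abbreviation set_mask :: "'v list \<Rightarrow> 'v set \<Rightarrow> btree" where
  "set_mask xs A \<equiv> bits xs (\<lambda>v. v \<in> A)"

definition entry :: "'v list \<Rightarrow> ('v, 'e) pre_digraph \<Rightarrow> ('v \<Rightarrow> rat) \<Rightarrow> 'v \<Rightarrow> btree" where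
  "entry xs G w u = Node (enc_rat (w u)) (bits xs (\<lambda>v. (u, v) \<in> arcs_ends G))"

lemma enc_instance_entry: "enc_instance xs G w = enc_list (map (entry xs G w) xs)"
  by (simp add: enc_instance_def entry_def[abs_def] bits_def)

lemma right_entry [simp]: "right (entry xs G w u) = bits xs (\<lambda>v. (u, v) \<in> arcs_ends G)"
  and left_entry [simp]: "left (entry xs G w u) = enc_rat (w u)"
  by (simp_all add: entry_def)

lemma bits_cong: "(\<And>v. v \<in> set xs \<Longrightarrow> P v = Q v) \<Longrightarrow> bits xs P = bits xs Q"
  by (simp add: bits_def)

text \<open>Rows and masks are indexed by the same vertex list, so pairing their bits turns each
  mask operation into a statement about single vertices.\<close>

lemma dec_list_zip_tree_map:
  "dec_list (zip_tree (enc_list (map f xs)) (enc_list (map g xs))) = map (\<lambda>v. Node (f v) (g v)) xs"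
  by (induction xs) (auto simp: zip_tree_def)

lemma same_bits_bits: "same_bits (bits xs P) (bits xs Q) \<longleftrightarrow> (\<forall>v\<in>set xs. P v = Q v)"
  unfolding same_bits_def bits_def dec_list_zip_tree_map by auto

lemma mixed_bits_bits: "mixed_bits (bits xs P) (bits xs Q) \<longleftrightarrow>
    (\<exists>v\<in>set xs. P v \<and> Q v) \<and> (\<exists>v\<in>set xs. \<not> P v \<and> Q v)"
  unfolding mixed_bits_def bits_def dec_list_zip_tree_map by auto

lemma submask_bits: "submask (bits xs P) (bits xs Q) \<longleftrightarrow> (\<forall>v\<in>set xs. P v \<longrightarrow> Q v)"
  unfolding submask_def bits_def dec_list_zip_tree_map by auto

lemma select_bits: "select (bits xs P) (enc_list (map g xs)) = enc_list (map g (filter P xs))"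
  unfolding select_def bits_def dec_list_zip_tree_map dec_enc_list
  by (simp add: filter_map comp_def)

lemma select_bits_bits: "select (bits xs P) (bits xs Q) = bits (filter P xs) Q"
  unfolding bits_def[of _ Q] by (rule select_bits)

lemma flip_mask_bits: "flip_mask (bits xs P) = bits xs (\<lambda>v. \<not> P v)"
  by (simp add: flip_mask_def bits_def comp_def)

context tournament
begin

lemma grow_mask_enc:
  assumes "set xs = verts G" "A \<subseteq> verts G"
  shows "grow_mask (enc_instance xs G w) (set_mask xs A) = set_mask xs (grow_set A)"
proof -
  have "grow_mask (enc_instance xs G w) (set_mask xs A) = bits xs (\<lambda>v. v \<in> A \<or>
    mixed_bits (bits xs (\<lambda>u. (v, u) \<in> arcs_ends G)) (set_mask xs A))"
    unfolding grow_mask_def enc_instance_entry bits_def[of xs "\<lambda>v. v \<in> A"] dec_list_zip_tree_map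
    by (auto simp: bits_def)
  also have "\<dots> = set_mask xs (grow_set A)"
    using assms unfolding mixed_bits_bits grow_set_def by (intro bits_cong) blast
  finally show ?thesis .
qed

lemma close_mask_enc:
  assumes "set xs = verts G" "distinct xs" "A \<subseteq> verts G"
  shows "close_mask (enc_instance xs G w) (set_mask xs A) = set_mask xs (close_set A)"
proof -
  have "fold (\<lambda>_. grow_mask (enc_instance xs G w)) ys (set_mask xs A) = set_mask xs ((grow_set ^^ length ys) A)"
    for ys :: "btree list"
  proof (induction ys rule: rev_induct)
    case (snoc y ys)
    have "(grow_set ^^ length ys) A \<subseteq> verts G"
      by (rule funpow_grow_set_subset_homogeneous[OF homogeneous_verts assms(3)])
    from grow_mask_enc[OF assms(1) this] snoc show ?case by simp
  qed simp
  \<comment> \<open>Since \<open>xs\<close> is distinct, the number of rounds, one per list entry,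
    is the number that \<open>close_set\<close> prescribes.\<close>
  then show ?thesis using distinct_card[OF assms(2)] assms(1)
    by (simp add: close_mask_def close_set_def enc_instance_entry)
qed

text \<open>The columns of \<open>u\<close> and \<open>v\<close> tell the rows apart: the diagonal
  is empty, while one of the two arcs between distinct vertices is present.\<close>

lemma same_bits_row:
  assumes "set xs = verts G" "u \<in> verts G" "v \<in> verts G"
  shows "same_bits (bits xs (\<lambda>z. (u, z) \<in> arcs_ends G)) (bits xs (\<lambda>z. (v, z) \<in> arcs_ends G)) \<longleftrightarrow> u = v"
proof
  assume "same_bits (bits xs (\<lambda>z. (u, z) \<in> arcs_ends G)) (bits xs (\<lambda>z. (v, z) \<in> arcs_ends G))"
  then have "(u, u) \<in> arcs_ends G \<longleftrightarrow> (v, u) \<in> arcs_ends G" "(u, v) \<in> arcs_ends G \<longleftrightarrow> (v, v) \<in> arcs_ends G"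
    using assms unfolding same_bits_bits by blast+
  then show "u = v" using arcs_ends_irrefl one_arc[of u v] assms by blast
qed (simp add: same_bits_bits)

lemma pair_mask_enc:
  assumes "set xs = verts G" "u \<in> verts G" "v \<in> verts G"
  shows "pair_mask (enc_instance xs G w) (entry xs G w u) (entry xs G w v) = set_mask xs {u, v}"
proof -
  have "pair_mask (enc_instance xs G w) (entry xs G w u) (entry xs G w v) = bits xs (\<lambda>z.
    same_bits (bits xs (\<lambda>y. (z, y) \<in> arcs_ends G)) (bits xs (\<lambda>y. (u, y) \<in> arcs_ends G)) \<or>
    same_bits (bits xs (\<lambda>y. (z, y) \<in> arcs_ends G)) (bits xs (\<lambda>y. (v, y) \<in> arcs_ends G)))"
    by (simp add: pair_mask_def enc_instance_entry bits_def[of xs "\<lambda>v. _ v \<or> _ v"] comp_def)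
  also have "\<dots> = set_mask xs {u, v}"
    using assms same_bits_row by (intro bits_cong) auto
  finally show ?thesis .
qed

lemma refine_mask_enc:
  assumes "set xs = verts G" "distinct xs" "u \<in> verts G" "v \<in> verts G"
  shows "refine_mask (enc_instance xs G w) (entry xs G w u) (entry xs G w v) (set_mask xs X) =
    set_mask xs (refine_set u v X)"
proof -
  have "submask (set_mask xs {u, v}) (set_mask xs X) \<longleftrightarrow> {u, v} \<subseteq> X"
    using assms by (auto simp: submask_bits)
  then show ?thesis
    using assms same_bits_row[OF assms(1,3,4)] close_mask_enc[OF assms(1,2), of "{u, v}" w]
    unfolding refine_mask_def refine_set_def pair_mask_enc[OF assms(1,3,4)] by simp
qed

lemma find_module_enc:
  assumes "set xs = verts G" "distinct xs"
  shows "find_module (enc_instance xs G w) =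
    set_mask xs (fold (\<lambda>u X. fold (\<lambda>v X. refine_set u v X) xs X) xs (verts G))"
proof -
  let ?L = "enc_instance xs G w" and ?e = "entry xs G w"
  have inner: "fold (\<lambda>v X. refine_mask ?L (?e u) v X) (map ?e ys) (set_mask xs X) =
      set_mask xs (fold (\<lambda>v X. refine_set u v X) ys X)" if "u \<in> verts G" "set ys \<subseteq> verts G" for u ys X
    using that(2)
  proof (induction ys arbitrary: X)
    case (Cons y ys) then show ?case using refine_mask_enc[OF assms that(1)] by simp
  qed simp
  have outer: "fold (\<lambda>u X. fold (\<lambda>v X. refine_mask ?L u v X) (map ?e xs) X) (map ?e ys) (set_mask xs X) =
      set_mask xs (fold (\<lambda>u X. fold (\<lambda>v X. refine_set u v X) xs X) ys X)" if "set ys \<subseteq> verts G" for ys X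
    using that
  proof (induction ys arbitrary: X)
    case (Cons y ys) then show ?case using inner[of y xs X] assms(1) by simp
  qed simp
  have "enc_list (map (\<lambda>e. enc_bool True) (dec_list ?L)) = set_mask xs (verts G)"
    using assms(1) unfolding bits_def enc_instance_entry by simp
  then show ?thesis
    using outer[of xs "verts G"] assms(1) unfolding find_module_def
    by (simp add: enc_instance_entry)
qed

end

section \<open>Sub-instances and contracted instances\<close>

lemma enc_instance_induce:
  assumes "set xs \<subseteq> X"
  shows "enc_instance xs (G \<restriction> X) w = enc_instance xs G w"
  using assms unfolding enc_instance_def arcs_ends_induce
  by (intro arg_cong[of _ _ enc_list] map_cong) auto

lemma sub_instance_enc:
  "sub_instance (set_mask xs X) (enc_instance xs G w) = enc_instance (filter (\<lambda>v. v \<in> X) xs) (G \<restriction> X) w"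
proof -
  have "sub_instance (set_mask xs X) (enc_instance xs G w) = enc_instance (filter (\<lambda>v. v \<in> X) xs) G w"
    unfolding sub_instance_def enc_instance_entry select_bits
    by (simp add: select_bits_bits entry_def)
  then show ?thesis by (subst enc_instance_induce) auto
qed

lemma contract_enc:
  assumes "filter (\<lambda>v. v \<in> X) xs = x # ys"
  shows "contract (set_mask xs X) (enc_rat W) (enc_instance xs G w) =
    enc_instance (x # filter (\<lambda>v. v \<notin> X) xs) (G \<restriction> insert x (set xs - X)) (w(x := W))"
proof -
  let ?zs = "filter (\<lambda>v. v \<notin> X) xs"
  have x: "x \<in> X" "x \<in> set xs" using arg_cong[OF assms, of set] by auto
  \<comment> \<open>Each row is permuted and cut down exactly as the list of vertices is.\<close>
  have row: "Node (left (select (set_mask xs X) (bits xs P))) (select (flip_mask (set_mask xs X)) (bits xs P)) =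
      bits (x # ?zs) P" for P
    unfolding flip_mask_bits select_bits_bits assms by (simp add: bits_def)
  have "contract (set_mask xs X) (enc_rat W) (enc_instance xs G w) =
    enc_list (map (\<lambda>e. Node (left e) (Node (left (select (set_mask xs X) (right e)))
      (select (flip_mask (set_mask xs X)) (right e))))
      (Node (enc_rat W) (bits xs (\<lambda>v. (x, v) \<in> arcs_ends G)) # map (entry xs G w) ?zs))"
    unfolding contract_def enc_instance_entry flip_mask_bits select_bits assms by simp
  also have "\<dots> = enc_list (Node (enc_rat W) (bits (x # ?zs) (\<lambda>v. (x, v) \<in> arcs_ends G)) #
      map (\<lambda>u. Node (enc_rat (w u)) (bits (x # ?zs) (\<lambda>v. (u, v) \<in> arcs_ends G))) ?zs)"
    by (simp add: row comp_def)
  also have "\<dots> = enc_instance (x # ?zs) G (w(x := W))"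
    unfolding enc_instance_entry entry_def using x by auto
  finally show ?thesis by (subst enc_instance_induce) auto
qed

section \<open>The size of the weights\<close>

text \<open>Each binary digit costs one list cell and at most one node for the digit.\<close>

lemma size_enc_nat_le: "n < 2 ^ k \<Longrightarrow> size (enc_nat n) \<le> 2 * k"
proof (induction k arbitrary: n)
  case 0 then show ?case by (simp add: enc_nat.simps)
next
  case (Suc k)
  have "size (enc_nat (n div 2)) \<le> 2 * k" using Suc.prems by (intro Suc.IH) auto
  then show ?case using size_enc_bool_le[of "odd n"] by (subst enc_nat.simps) auto
qed

text \<open>Each digit costs at least one node, so the size of an input limits the numbers in
  it.\<close>

lemma less_power_size_enc_nat: "n < 2 ^ size (enc_nat n)"
proof (induction n rule: less_induct)
  case (less n)
  show ?case
  proof (cases "n = 0")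
    case False
    then have "n div 2 < 2 ^ size (enc_nat (n div 2))" by (intro less.IH) simp
    then have "n < 2 ^ Suc (size (enc_nat (n div 2)))" by auto
    also have "\<dots> \<le> 2 ^ size (enc_nat n)"
      using False by (subst (2) enc_nat.simps) (intro power_increasing, auto)
    finally show ?thesis .
  qed simp
qed

definition numer :: "rat \<Rightarrow> nat" where "numer r = nat (fst (quotient_of r))"
definition denom :: "rat \<Rightarrow> nat" where "denom r = nat (snd (quotient_of r))"

lemma enc_rat_numer_denom: "enc_rat r = Node (enc_nat (numer r)) (enc_nat (denom r))"
  by (simp add: enc_rat_def numer_def denom_def case_prod_beta)

lemma denom_pos: "0 < denom r"
  using quotient_of_denom_pos' by (simp add: denom_def)

lemma rat_numer_denom:
  assumes "0 \<le> r"
  shows "r * of_nat (denom r) = of_nat (numer r)" "coprime (numer r) (denom r)"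
proof -
  obtain a b where ab: "quotient_of r = (a, b)" by fastforce
  have b: "0 < b" using quotient_of_denom_pos[OF ab] .
  have r: "r = of_int a / of_int b" using quotient_of_div[OF ab] .
  have a: "0 \<le> a" using assms b unfolding r by (simp add: zero_le_divide_iff)
  have "r * of_nat (denom r) = r * of_int b" using b by (simp add: denom_def ab)
  also have "\<dots> = of_int a" using b by (simp add: r)
  also have "\<dots> = of_nat (numer r)" using a by (simp add: numer_def ab)
  finally show "r * of_nat (denom r) = of_nat (numer r)" .
  show "coprime (numer r) (denom r)"
    using quotient_of_coprime[OF ab] a b
    by (simp add: numer_def denom_def ab) (metis coprime_int_iff int_nat_eq less_le)
qed

text \<open>In lowest terms the denominator of \<open>r\<close> divides every \<open>d\<close> that
  makes \<open>r * of_nat d\<close> integral, and then the numerator is at most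
  \<open>s * of_nat d\<close>.\<close>

lemma size_enc_rat_le:
  assumes "0 \<le> r" "r * of_nat d \<in> \<int>" "0 < d" "d < 2 ^ a" "r \<le> s" "s * of_nat d < 2 ^ b"
  shows "size (enc_rat r) \<le> 2 * a + 2 * b + 1"
proof -
  obtain z where z: "r * of_nat d = of_int z" using assms(2) by (auto elim: Ints_cases)
  have "of_nat (numer r * d) = (of_int (z * int (denom r)) :: rat)"
    using z rat_numer_denom(1)[OF assms(1)] by (simp add: mult.commute mult.left_commute)
      (metis mult.assoc mult.commute)
  then have "int (numer r * d) = z * int (denom r)"
    by (metis of_int_eq_iff of_int_of_nat_eq)
  then have "denom r dvd numer r * d" by (metis dvd_triv_right int_dvd_int_iff)
  then have dvd: "denom r dvd d"
    using rat_numer_denom(2)[OF assms(1)] coprime_dvd_mult_right_iff coprime_commute by metis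
  then have le: "denom r \<le> d" using assms(3) by (simp add: dvd_imp_le)
  have "(of_nat (numer r) :: rat) = r * of_nat (denom r)" using rat_numer_denom(1)[OF assms(1)] by simp
  also have "\<dots> \<le> s * of_nat d" using assms(1,5) le by (intro mult_mono) auto
  also have "\<dots> < 2 ^ b" by (rule assms(6))
  finally have "numer r < 2 ^ b" by (metis of_nat_less_iff of_nat_numeral of_nat_power)
  then have "size (enc_nat (numer r)) \<le> 2 * b" by (rule size_enc_nat_le)
  moreover have "size (enc_nat (denom r)) \<le> 2 * a" using le assms(4) by (intro size_enc_nat_le) simp
  ultimately show ?thesis by (simp add: enc_rat_numer_denom)
qed

text \<open>A common denominator. A product suffices in place of the least common multiple: its
  length is at most the sum of the lengths of its factors, all of which occur in the
  instance.\<close>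

definition weight_denom :: "'v set \<Rightarrow> ('v \<Rightarrow> rat) \<Rightarrow> nat" where
  "weight_denom V w = (\<Prod>v\<in>V. denom (w v))"

lemma weight_denom_integral:
  assumes "finite V" "v \<in> V" "0 \<le> w v"
  shows "w v * of_nat (weight_denom V w) \<in> \<int>"
proof -
  obtain k where "weight_denom V w = denom (w v) * k"
    using dvd_prodI[OF assms(1,2), of "\<lambda>v. denom (w v)"] unfolding weight_denom_def dvd_def by auto
  then have "w v * of_nat (weight_denom V w) = of_nat (numer (w v)) * of_nat k"
    using rat_numer_denom(1)[OF assms(3)] by (simp add: mult.assoc[symmetric])
  then show ?thesis by simp
qed

lemma sum_size_weights_le:
  assumes "distinct xs"
  shows "card (set xs) + (\<Sum>v\<in>set xs. size (enc_rat (w v))) \<le> size (enc_instance xs G w)"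
proof -
  have "(\<Sum>v\<in>set xs. size (enc_rat (w v))) = sum_list (map (\<lambda>v. size (enc_rat (w v))) xs)"
    using assms by (simp add: sum_list_distinct_conv_sum_set)
  also have "\<dots> \<le> sum_list (map (\<lambda>v. size (entry xs G w v)) xs)"
    by (intro sum_list_mono) (simp add: entry_def)
  finally show ?thesis
    using distinct_card[OF assms] by (simp add: enc_instance_entry size_enc_list comp_def)
qed

text \<open>Each weight, the number of weights and the common denominator are at most
  2^\<open>N\<close>, which gives the three factors of the last bound; the additional 1 in the
  exponents makes the inequalities strict.\<close>

lemma weight_bounds:
  fixes w :: "'v \<Rightarrow> rat" and G :: "('v, 'e) pre_digraph"
  assumes "distinct xs" "\<And>v. v \<in> set xs \<Longrightarrow> 0 \<le> w v"
  defines "N \<equiv> size (enc_instance xs G w)"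
  shows "0 < weight_denom (set xs) w" "weight_denom (set xs) w < 2 ^ (N + 1)"
    and "(\<Sum>v\<in>set xs. w v) * of_nat (weight_denom (set xs) w) < 2 ^ (3 * N + 1)"
proof -
  show "0 < weight_denom (set xs) w" by (simp add: weight_denom_def denom_pos)
  have N: "card (set xs) + (\<Sum>v\<in>set xs. size (enc_rat (w v))) \<le> N"
    unfolding N_def by (rule sum_size_weights_le[OF assms(1)])
  have "weight_denom (set xs) w \<le> (\<Prod>v\<in>set xs. 2 ^ size (enc_rat (w v)))"
    unfolding weight_denom_def
  proof (intro prod_mono conjI)
    fix v
    have "denom (w v) < 2 ^ size (enc_nat (denom (w v)))" by (rule less_power_size_enc_nat)
    also have "\<dots> \<le> 2 ^ size (enc_rat (w v))" by (intro power_increasing) (auto simp: enc_rat_numer_denom)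
    finally show "denom (w v) \<le> 2 ^ size (enc_rat (w v))" by simp
  qed simp
  also have "\<dots> = 2 ^ (\<Sum>v\<in>set xs. size (enc_rat (w v)))" by (simp add: power_sum)
  also have "\<dots> \<le> 2 ^ N" using N by (intro power_increasing) auto
  finally have d: "weight_denom (set xs) w \<le> 2 ^ N" .
  then show "weight_denom (set xs) w < 2 ^ (N + 1)" by (rule le_less_trans) simp
  have wv: "w v \<le> 2 ^ N" if v: "v \<in> set xs" for v
  proof -
    have "w v * 1 \<le> w v * of_nat (denom (w v))"
      using assms(2)[OF v] denom_pos[of "w v"] by (intro mult_left_mono) (auto simp: Suc_leI)
    also have "\<dots> = of_nat (numer (w v))" by (rule rat_numer_denom(1)[OF assms(2)[OF v]])
    also have "\<dots> \<le> of_nat (2 ^ N)"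
    proof (intro of_nat_mono)
      have "numer (w v) < 2 ^ size (enc_nat (numer (w v)))" by (rule less_power_size_enc_nat)
      also have "size (enc_nat (numer (w v))) \<le> size (enc_rat (w v))" by (simp add: enc_rat_numer_denom)
      also have "size (enc_rat (w v)) \<le> (\<Sum>v\<in>set xs. size (enc_rat (w v)))"
        using v by (intro member_le_sum) auto
      finally show "numer (w v) \<le> 2 ^ N" using N
        by (meson add_leD2 less_imp_le_nat less_le_trans one_le_numeral power_increasing)
    qed
    finally show ?thesis by simp
  qed
  have "(\<Sum>v\<in>set xs. w v) \<le> of_nat (card (set xs)) * 2 ^ N" using wv by (rule sum_bounded_above)
  also have "(of_nat (card (set xs)) :: rat) \<le> of_nat (2 ^ N)"
  proof (intro of_nat_mono)
    have "card (set xs) < 2 ^ card (set xs)" by (rule less_exp)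
    also have "\<dots> \<le> 2 ^ N" using N by (intro power_increasing) auto
    finally show "card (set xs) \<le> 2 ^ N" by simp
  qed
  finally have "(\<Sum>v\<in>set xs. w v) \<le> 2 ^ N * 2 ^ N" by simp
  moreover have "(of_nat (weight_denom (set xs) w) :: rat) \<le> 2 ^ N"
    using of_nat_mono[OF d, where ?'a = rat] by simp
  ultimately have "(\<Sum>v\<in>set xs. w v) * of_nat (weight_denom (set xs) w) \<le> 2 ^ N * 2 ^ N * 2 ^ N"
    by (intro mult_mono) auto
  also have "\<dots> = 2 ^ (3 * N)" by (simp add: power_add[symmetric])
  also have "\<dots> < 2 ^ (3 * N + 1)" by simp
  finally show "(\<Sum>v\<in>set xs. w v) * of_nat (weight_denom (set xs) w) < 2 ^ (3 * N + 1)" .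
qed

text \<open>
  Every weight met during the contraction is a sum of original weights, hence has a denominator
  dividing the product of the original ones, and is at most their sum.
\<close>

definition bounded_weights :: "nat \<Rightarrow> rat \<Rightarrow> 'v set \<Rightarrow> ('v \<Rightarrow> rat) \<Rightarrow> bool" where
  "bounded_weights d s V w \<longleftrightarrow> (\<forall>v\<in>V. 0 \<le> w v \<and> w v * of_nat d \<in> \<int>) \<and> sum w V \<le> s"

lemma sum_Ints: "(\<And>v. v \<in> S \<Longrightarrow> f v \<in> \<int>) \<Longrightarrow> sum f S \<in> \<int>"
  by (induction S rule: infinite_finite_induct) auto

lemma (in tournament) max_independent_weight_bounds:
  assumes "bounded_weights d s (verts G) w"
  shows "0 \<le> max_independent_weight G w" "max_independent_weight G w * of_nat d \<in> \<int>"
    and "max_independent_weight G w \<le> sum w (verts G)"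
proof -
  obtain S where S: "independent_set G S" "sum w S = max_independent_weight G w"
    by (rule max_independent_weight_attained)
  have SV: "S \<subseteq> verts G" using S(1) by (simp add: independent_set_def)
  show "0 \<le> max_independent_weight G w"
    unfolding S(2)[symmetric] using SV assms by (intro sum_nonneg) (auto simp: bounded_weights_def)
  show "max_independent_weight G w * of_nat d \<in> \<int>"
    unfolding S(2)[symmetric] sum_distrib_right using SV assms
    by (intro sum_Ints) (auto simp: bounded_weights_def)
  show "max_independent_weight G w \<le> sum w (verts G)"
    unfolding S(2)[symmetric] using SV assms
    by (intro sum_mono2) (auto simp: bounded_weights_def)
qed

text \<open>The size bound under which the solver counts as a computable function. With
  \<open>N\<close> the size of the instance, 8 \<open>N\<close> + 5 = 2 (\<open>N\<close> + 1) + 2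
  (3 \<open>N\<close> + 1) + 1, by \<open>size_enc_rat_le\<close> with the exponents of
  \<open>weight_bounds\<close>.\<close>

lemma (in tournament) size_enc_rat_max_independent_weight:
  assumes "distinct xs" "set xs = verts G" "\<forall>v\<in>verts G. 0 \<le> w v"
  shows "size (enc_rat (max_independent_weight G w)) \<le> 8 * size (enc_instance xs G w) + 5"
proof -
  let ?d = "weight_denom (verts G) w"
  have "bounded_weights ?d (sum w (verts G)) (verts G) w"
    using assms(3) weight_denom_integral[of "verts G" _ w] by (auto simp: bounded_weights_def)
  note b = max_independent_weight_bounds[OF this]
  have nn: "\<And>v. v \<in> set xs \<Longrightarrow> 0 \<le> w v" using assms by auto
  note wb = weight_bounds(1)[OF assms(1) nn, unfolded assms(2)]
    weight_bounds(2,3)[OF assms(1) nn, where G = G, unfolded assms(2)]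
  from size_enc_rat_le[OF b(1,2) wb(1,2) b(3) wb(3)] show ?thesis by simp
qed

section \<open>The reduction\<close>

text \<open>The loop invariant. The common denominator \<open>d\<close>, the total weight
  \<open>s\<close> and the optimum \<open>m\<close> will be those of the original instance and stay
  fixed, so the size bounds do not compound over the rounds; \<open>n\<close> limits the number of
  vertices left.\<close>

definition reduced_instance ::
    "('a, 'b) pre_digraph \<Rightarrow> nat \<Rightarrow> rat \<Rightarrow> rat \<Rightarrow> nat \<Rightarrow> btree \<Rightarrow> bool" where
  "reduced_instance H d s m n L \<longleftrightarrow> (\<exists>ys (G :: (nat, nat \<times> nat) pre_digraph) w.
    L = enc_instance ys G w \<and> tournament G \<and> is_free_of G H \<and> distinct ys \<and> set ys = verts G \<and>
    bounded_weights d s (verts G) w \<and> max_independent_weight G w = m \<and> ys \<noteq> [] \<and> length ys \<le> n)"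

abbreviation (input) free_tournaments :: "('a, 'b) pre_digraph \<Rightarrow> (nat, nat \<times> nat) pre_digraph set" where
  "free_tournaments H \<equiv> {G. tournament G \<and> is_free_of G H}"

abbreviation (input) prime_free_tournaments :: "('a, 'b) pre_digraph \<Rightarrow> (nat, nat \<times> nat) pre_digraph set" where
  "prime_free_tournaments H \<equiv> {G. prime_tournament G \<and> is_free_of G H}"

lemma module_instance:
  fixes G :: "(nat, nat \<times> nat) pre_digraph"
  assumes "tournament G" "is_free_of G H" "distinct xs" "set xs = verts G" "\<forall>v\<in>verts G. 0 \<le> w v"
    and "right (enc_instance xs G w) \<noteq> Leaf"
  obtains X where "homogeneous G X" "\<exists>u\<in>X. \<exists>v\<in>X. u \<noteq> v" "find_module (enc_instance xs G w) = set_mask xs X"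
    "(sub_instance (set_mask xs X) (enc_instance xs G w), enc_rat (max_independent_weight (G \<restriction> X) w))
      \<in> WMISP (prime_free_tournaments H)"
proof -
  interpret tournament G by fact
  let ?X = "fold (\<lambda>u X. fold (\<lambda>v X. refine_set u v X) xs X) xs (verts G)"
  obtain a b ys where "xs = a # b # ys"
    using assms(6) by (cases xs; cases "tl xs") (auto simp: enc_instance_def)
  then have "\<exists>u\<in>verts G. \<exists>v\<in>verts G. u \<noteq> v"
    using assms(3,4) by (metis distinct_length_2_or_more list.set_intros)
  then have X: "minimal_module ?X" by (rule minimal_module_fold_refine_set[OF assms(4)])
  then have hom: "homogeneous G ?X" and XV: "?X \<subseteq> verts G" by (auto simp: minimal_module_def homogeneous_def)
  have "prime_tournament (G \<restriction> ?X)" "is_free_of (G \<restriction> ?X) H" "tournament (G \<restriction> ?X)"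
    using prime_minimal_module[OF X] is_free_of_induce[OF XV assms(2)] tournament_induce[OF XV] by auto
  then have "(enc_instance (filter (\<lambda>v. v \<in> ?X) xs) (G \<restriction> ?X) w,
      enc_rat (max_independent_weight (G \<restriction> ?X) w)) \<in> WMISP (prime_free_tournaments H)"
    unfolding WMISP_def using assms(3,4,5) XV
    by (auto intro!: exI[of _ "filter (\<lambda>v. v \<in> ?X) xs"] exI[of _ "G \<restriction> ?X"] exI[of _ w])
  with X hom show thesis
    using that find_module_enc[OF assms(4,3)] unfolding sub_instance_enc minimal_module_def by blast
qed

text \<open>A module has at least two vertices, so a contraction removes at least one; a single
  vertex is left alone, hence the maximum with 1. The total weight does not grow, as the optimum in
  \<open>X\<close> is at most the weight of \<open>X\<close>.\<close>

lemma reduced_instance_contract_step: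
  assumes f: "\<forall>(x, y)\<in>WMISP (prime_free_tournaments H). f x = y"
    and "reduced_instance H d s m n L"
  shows "reduced_instance H d s m (max 1 (n - 1)) (contract_step f L)"
proof -
  from assms(2) obtain xs w and G :: "(nat, nat \<times> nat) pre_digraph" where
    L: "L = enc_instance xs G w" and G: "tournament G" "is_free_of G H" and
    xs: "distinct xs" "set xs = verts G" "xs \<noteq> []" "length xs \<le> n" and
    w: "bounded_weights d s (verts G) w" and m: "max_independent_weight G w = m"
    unfolding reduced_instance_def by blast
  interpret tournament G by fact
  have w0: "\<forall>v\<in>verts G. 0 \<le> w v" using w by (simp add: bounded_weights_def)
  show ?thesis
  proof (cases "right L = Leaf")
    case True
    then have "length xs = 1" using xs(3) unfolding L enc_instance_def by (cases xs; cases "tl xs") auto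
    with True show ?thesis using L G xs w m unfolding reduced_instance_def contract_step_def
      by (intro exI[of _ xs] exI[of _ G] exI[of _ w]) simp
  next
    case False
    obtain X where X: "homogeneous G X" "\<exists>u\<in>X. \<exists>v\<in>X. u \<noteq> v" "find_module L = set_mask xs X"
      "(sub_instance (set_mask xs X) L, enc_rat (max_independent_weight (G \<restriction> X) w))
        \<in> WMISP (prime_free_tournaments H)"
      using module_instance[OF G xs(1,2) w0] False unfolding L by blast
    let ?W = "max_independent_weight (G \<restriction> X) w"
    have XV: "X \<subseteq> verts G" using X(1) by (simp add: homogeneous_def)
    have card: "2 \<le> card X"
    proof -
      obtain u v where uv: "u \<in> X" "v \<in> X" "u \<noteq> v" using X(2) by blast
      then have "card {u, v} \<le> card X"
        using XV by (intro card_mono) (auto intro: finite_subset[OF _ finite_verts])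
      then show ?thesis using uv by simp
    qed
    obtain x zs where x: "filter (\<lambda>v. v \<in> X) xs = x # zs"
    proof (cases "filter (\<lambda>v. v \<in> X) xs")
      case Nil
      then show ?thesis using X(2) XV xs(2) by (auto simp: filter_empty_conv)
    qed
    have xX: "x \<in> X" using arg_cong[OF x, of set] by auto
    let ?ys = "x # filter (\<lambda>v. v \<notin> X) xs" and ?Y = "insert x (verts G - X)"
    have YV: "?Y \<subseteq> verts G" using xX XV by auto
    have step: "contract_step f L = enc_instance ?ys (G \<restriction> ?Y) (w(x := ?W))"
      using f X(3,4) False contract_enc[OF x, of ?W G w] xs(2) L by (auto simp: contract_step_def)
    have "bounded_weights d (sum w X) X w"
      using w XV by (auto simp: bounded_weights_def)
    then have W: "0 \<le> ?W" "?W * of_nat d \<in> \<int>" "?W \<le> sum w X"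
      using tournament.max_independent_weight_bounds[OF tournament_induce[OF XV], of d "sum w X" w]
      by simp_all
    have "bounded_weights d s ?Y (w(x := ?W))"
      unfolding bounded_weights_def
    proof (intro conjI ballI)
      fix v assume "v \<in> ?Y"
      then show "0 \<le> (w(x := ?W)) v" "(w(x := ?W)) v * of_nat d \<in> \<int>"
        using W w by (auto simp: bounded_weights_def)
    next
      have "sum (w(x := ?W)) ?Y = ?W + sum (w(x := ?W)) (verts G - X)" using xX by simp
      also have "sum (w(x := ?W)) (verts G - X) = sum w (verts G - X)"
        using xX by (intro sum.cong) auto
      also have "?W + sum w (verts G - X) \<le> sum w X + sum w (verts G - X)" using W by simp
      also have "\<dots> = sum w (verts G)" using XV by (simp add: sum.subset_diff[of X "verts G"])
      also have "\<dots> \<le> s" using w by (simp add: bounded_weights_def)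
      finally show "sum (w(x := ?W)) ?Y \<le> s" .
    qed
    moreover have "length ?ys \<le> max 1 (n - 1)"
    proof -
      have "set (filter (\<lambda>v. v \<in> X) xs) = X" using xs(2) XV by auto
      then have "length (filter (\<lambda>v. v \<in> X) xs) = card X"
        using distinct_card[of "filter (\<lambda>v. v \<in> X) xs"] xs(1) by (simp del: set_filter)
      then show ?thesis using sum_length_filter_compl[of "\<lambda>v. v \<in> X" xs] card xs(4) by simp
    qed
    moreover have "tournament (G \<restriction> ?Y)" "is_free_of (G \<restriction> ?Y) H"
      using tournament_induce[OF YV] is_free_of_induce[OF YV G(2)] by auto
    moreover have "max_independent_weight (G \<restriction> ?Y) (w(x := ?W)) = m"
      using max_independent_weight_contract[OF X(1) xX] m by simp
    moreover have "distinct ?ys" "set ?ys = verts (G \<restriction> ?Y)" using xs xX by auto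
    ultimately show ?thesis unfolding reduced_instance_def step
      by (intro exI[of _ ?ys] exI[of _ "G \<restriction> ?Y"] exI[of _ "w(x := ?W)"]) simp
  qed
qed

lemma reduced_instance_fold_contract_step:
  assumes f: "\<forall>(x, y)\<in>WMISP (prime_free_tournaments H). f x = y"
    and "reduced_instance H d s m n L"
  shows "reduced_instance H d s m (max 1 (n - length (ys :: btree list)))
    (fold (\<lambda>_. contract_step f) ys L)"
proof (induction ys rule: rev_induct)
  case Nil
  then show ?case using assms(2) by (fastforce simp: reduced_instance_def)
next
  case (snoc y ys)
  have "max 1 (max 1 (n - length ys) - 1) = max 1 (n - length (ys @ [y]))" by simp
  with reduced_instance_contract_step[OF f snoc] show ?case by (simp del: max_Suc_Suc)
qed

lemma reduced_instance_initial:
  fixes G :: "(nat, nat \<times> nat) pre_digraph"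
  assumes "tournament G" "is_free_of G H" "distinct xs" "set xs = verts G" "\<forall>v\<in>verts G. 0 \<le> w v" "xs \<noteq> []"
  shows "reduced_instance H (weight_denom (verts G) w) (sum w (verts G)) (max_independent_weight G w)
    (length xs) (enc_instance xs G w)"
proof -
  interpret tournament G by fact
  have "bounded_weights (weight_denom (verts G) w) (sum w (verts G)) (verts G) w"
    using assms(5) weight_denom_integral[of "verts G" _ w] by (auto simp: bounded_weights_def)
  then show ?thesis unfolding reduced_instance_def using assms by blast
qed

text \<open>Per vertex: 2 \<open>a\<close> + 2 \<open>b\<close> + 1 for the weight, 2
  \<open>n\<close> for the row, one node for the entry and one list cell.\<close>

lemma size_reduced_instance:
  assumes "reduced_instance H d s m n L" "0 < d" "d < 2 ^ a" "s * of_nat d < 2 ^ b"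
  shows "size L \<le> n * (2 * a + 2 * b + 2 * n + 3)"
proof -
  from assms(1) obtain xs w and G :: "(nat, nat \<times> nat) pre_digraph" where
    L: "L = enc_instance xs G w" and G: "tournament G" and
    xs: "set xs = verts G" "length xs \<le> n" and w: "bounded_weights d s (verts G) w"
    unfolding reduced_instance_def by blast
  interpret tournament G by fact
  have entry: "size (entry xs G w v) \<le> 2 * a + 2 * b + 2 * n + 2" if v: "v \<in> set xs" for v
  proof -
    have "w v \<le> sum w (verts G)"
      using v xs(1) w by (intro member_le_sum) (auto simp: bounded_weights_def)
    then have "w v \<le> s" using w by (simp add: bounded_weights_def)
    then have "size (enc_rat (w v)) \<le> 2 * a + 2 * b + 1"
      using v xs(1) w assms(2-4) by (intro size_enc_rat_le[of _ d]) (auto simp: bounded_weights_def)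
    moreover have "size (bits xs (\<lambda>u. (v, u) \<in> arcs_ends G)) \<le> 2 * n"
      using size_enc_bool_list[of "\<lambda>u. (v, u) \<in> arcs_ends G" xs] xs(2) by (simp add: bits_def)
    ultimately show ?thesis by (simp add: entry_def)
  qed
  have "sum_list (map (\<lambda>v. size (entry xs G w v)) xs) \<le>
      sum_list (map (\<lambda>v. 2 * a + 2 * b + 2 * n + 2) xs)"
    using entry by (rule sum_list_mono)
  then have "size L \<le> length xs * (2 * a + 2 * b + 2 * n + 3)"
    unfolding L enc_instance_entry size_enc_list by (simp add: comp_def sum_list_triv algebra_simps)
  also have "\<dots> \<le> n * (2 * a + 2 * b + 2 * n + 3)" using xs(2) by (rule mult_right_mono) simp
  finally show ?thesis .
qed

lemma solve_by_contraction_correct: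
  fixes G :: "(nat, nat \<times> nat) pre_digraph"
  assumes f: "\<forall>(x, y)\<in>WMISP (prime_free_tournaments H). f x = y"
    and G: "tournament G" "is_free_of G H" "distinct xs" "set xs = verts G" "\<forall>v\<in>verts G. 0 \<le> w v"
  shows "solve_by_contraction f (enc_instance xs G w) = enc_rat (max_independent_weight G w)"
proof (cases "xs = []")
  case True
  interpret tournament G by fact
  obtain S where "independent_set G S" "sum w S = max_independent_weight G w"
    by (rule max_independent_weight_attained)
  then show ?thesis using True G(4) by (auto simp: solve_by_contraction_def enc_instance_def independent_set_def)
next
  case False
  let ?L = "enc_instance xs G w"
  have len: "length (dec_list ?L) = length xs" by (simp add: enc_instance_def)
  \<comment> \<open>After as many rounds as there are vertices the bound
    \<open>max 1 (n - n)\<close> is 1, so exactly one vertex remains.\<close>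
  from reduced_instance_fold_contract_step[OF f reduced_instance_initial[OF G False], where ys = "dec_list ?L"]
  obtain ys w' and G' :: "(nat, nat \<times> nat) pre_digraph" where
    L': "fold (\<lambda>_. contract_step f) (dec_list ?L) ?L = enc_instance ys G' w'" and
    G': "tournament G'" "set ys = verts G'" "ys \<noteq> []" "length ys \<le> 1"
      "\<forall>v\<in>verts G'. 0 \<le> w' v" "max_independent_weight G' w' = max_independent_weight G w"
    unfolding reduced_instance_def len bounded_weights_def by auto
  interpret G': tournament G' by fact
  obtain v where v: "ys = [v]" using G'(3,4) by (cases ys) auto
  have V: "verts G' = {v}" using G'(2) v by simp
  have "max_independent_weight G' w' = w' v"
  proof (rule antisym)
    obtain S where S: "independent_set G' S" "sum w' S = max_independent_weight G' w'"
      by (rule G'.max_independent_weight_attained)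
    with V have "S = {} \<or> S = {v}" by (simp add: independent_set_def subset_singleton_iff)
    moreover have "0 \<le> w' v" using G'(5) V by simp
    ultimately have "sum w' S \<le> w' v" by auto
    then show "max_independent_weight G' w' \<le> w' v" using S by simp
    have "independent_set G' {v}" by (simp add: G'.independent_set_iff V)
    from G'.max_independent_weight_ge[OF this, of w'] show "w' v \<le> max_independent_weight G' w'" by simp
  qed
  moreover have "?L \<noteq> Leaf" using False by (cases xs) (auto simp: enc_instance_def)
  then have "solve_by_contraction f ?L = left (left (enc_instance ys G' w'))"
    by (simp add: solve_by_contraction_def L')
  moreover have "left (left (enc_instance ys G' w')) = enc_rat (w' v)"
    by (simp add: v enc_instance_def)
  ultimately show ?thesis using G'(6) by simp
qed

lemma WMISP_free_iff: "(x, y) \<in> WMISP (free_tournaments H) \<longleftrightarrow>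
  (\<exists>xs (G :: (nat, nat \<times> nat) pre_digraph) w. x = enc_instance xs G w \<and>
    y = enc_rat (max_independent_weight G w) \<and> tournament G \<and> is_free_of G H \<and> distinct xs \<and>
    set xs = verts G \<and> (\<forall>v\<in>verts G. 0 \<le> w v))"
  unfolding WMISP_def by auto

theorem theorem2p1p1:
  fixes H :: "('a, 'b) pre_digraph"
  assumes "tournament H"
    and "solvable_in_poly_time
      (WMISP {G :: (nat, nat \<times> nat) pre_digraph. prime_tournament G \<and> is_free_of G H})"
  shows "solvable_in_poly_time
      (WMISP {G :: (nat, nat \<times> nat) pre_digraph. tournament G \<and> is_free_of G H})"
proof -
  let ?P = "WMISP (prime_free_tournaments H)" and ?D = "Domain (WMISP (free_tournaments H))"
  obtain f where f: "\<And>x y. (x, y) \<in> ?P \<Longrightarrow> f x = y"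
    and FPf: "\<And>D q. D \<subseteq> Domain ?P \<Longrightarrow> (\<And>x. x \<in> D \<Longrightarrow> size (f x) \<le> poly q (size x)) \<Longrightarrow> FP D f"
    using FP_if_solvable[OF assms(2)] by blast
  have f': "\<forall>(x, y)\<in>?P. f x = y" using f by blast
  have "FP (Domain ?P) f"
  proof (rule FPf[OF subset_refl, where q = "[:5, 8:]"])
    fix x assume "x \<in> Domain ?P"
    then obtain xs w and G :: "(nat, nat \<times> nat) pre_digraph" where
      x: "x = enc_instance xs G w" "(x, enc_rat (max_independent_weight G w)) \<in> ?P" and
      G: "tournament G" "distinct xs" "set xs = verts G" "\<forall>v\<in>verts G. 0 \<le> w v"
      unfolding WMISP_def by blast
    from tournament.size_enc_rat_max_independent_weight[OF G]
    show "size (f x) \<le> poly [:5, 8:] (size x)" using f[OF x(2)] x(1) by (simp add: mult.commute)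
  qed
  then have step: "FP ?D (contract_step f)"
  proof (rule FP_contract_step)
    fix L assume L: "L \<in> ?D" "right L \<noteq> Leaf"
    then obtain xs w and G :: "(nat, nat \<times> nat) pre_digraph" where
      "L = enc_instance xs G w" "tournament G" "is_free_of G H" "distinct xs" "set xs = verts G"
      "\<forall>v\<in>verts G. 0 \<le> w v"
      by (auto simp: WMISP_free_iff)
    then obtain X where "find_module L = set_mask xs X"
      "(sub_instance (set_mask xs X) L, enc_rat (max_independent_weight (G \<restriction> X) w)) \<in> ?P"
      using module_instance[of G H xs w] L(2) by blast
    then show "sub_instance (find_module L) L \<in> Domain ?P" by auto
  qed
  \<comment> \<open>With \<open>N\<close> the size of the original instance, every intermediate tree
    has size at most \<open>N\<close> (10 \<open>N\<close> + 7), by the exponents \<open>N\<close> +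
    1 and 3 \<open>N\<close> + 1 and at most \<open>N\<close> vertices; the polynomial leaves some
    slack.\<close>
  have reduced: "fold (\<lambda>_. contract_step f) ys L \<in> ?D \<and>
      size (fold (\<lambda>_. contract_step f) ys L) \<le> poly ([:0, 1:] * [:11, 10:]) (size L)"
    if L: "L \<in> ?D" and ys: "dec_list L = ys @ zs" for L ys zs
  proof (cases "L = Leaf")
    \<comment> \<open>The invariant \<open>reduced_instance\<close> excludes the empty instance;
      there \<open>ys\<close> is empty and the fold changes nothing.\<close>
    case True then show ?thesis using L ys by simp
  next
    case False
    from L obtain xs w and G :: "(nat, nat \<times> nat) pre_digraph" where
      x: "L = enc_instance xs G w" and G: "tournament G" "is_free_of G H" "distinct xs" "set xs = verts G"
      "\<forall>v\<in>verts G. 0 \<le> w v"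
      by (auto simp: WMISP_free_iff)
    have ne: "xs \<noteq> []" using False x by (auto simp: enc_instance_def)
    let ?d = "weight_denom (verts G) w" and ?s = "sum w (verts G)" and ?N = "size L"
    let ?n = "max 1 (length xs - length ys)" and ?L' = "fold (\<lambda>_. contract_step f) ys L"
    have red: "reduced_instance H ?d ?s (max_independent_weight G w) ?n ?L'"
      unfolding x by (rule reduced_instance_fold_contract_step[OF f' reduced_instance_initial[OF G ne]])
    then obtain us w' and G' :: "(nat, nat \<times> nat) pre_digraph" where
      "?L' = enc_instance us G' w'" "tournament G'" "is_free_of G' H" "distinct us" "set us = verts G'"
      "\<forall>v\<in>verts G'. 0 \<le> w' v"
      unfolding reduced_instance_def bounded_weights_def by blast
    then have "(?L', enc_rat (max_independent_weight G' w')) \<in> WMISP (free_tournaments H)"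
      unfolding WMISP_free_iff by blast
    then have "?L' \<in> ?D" by blast
    moreover have "?n \<le> ?N"
    proof -
      have "length xs \<le> ?N" using length_dec_list_le[of L] by (simp add: x enc_instance_def)
      moreover have "1 \<le> length xs" using ne by (cases xs) auto
      ultimately show ?thesis by simp
    qed
    moreover have "size ?L' \<le> ?n * (2 * (?N + 1) + 2 * (3 * ?N + 1) + 2 * ?n + 3)"
    proof (rule size_reduced_instance[OF red])
      have nn: "\<And>v. v \<in> set xs \<Longrightarrow> 0 \<le> w v" using G(4,5) by auto
      show "0 < ?d" "?d < 2 ^ (?N + 1)" "?s * of_nat ?d < 2 ^ (3 * ?N + 1)"
        using weight_bounds(1)[OF G(3) nn] weight_bounds(2,3)[OF G(3) nn, where G = G]
        unfolding x G(4) by simp_all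
    qed
    ultimately have "size ?L' \<le> ?N * (2 * (?N + 1) + 2 * (3 * ?N + 1) + 2 * ?N + 3)"
      by (meson add_mono le_refl le_trans mult_le_mono)
    with \<open>?L' \<in> ?D\<close> show ?thesis by (simp add: algebra_simps)
  qed
  have "FP ?D (solve_by_contraction f)"
    by (rule FP_solve_by_contraction[OF step, where q = "[:0, 1:] * [:11, 10:]"]) (use reduced in blast)+
  then show ?thesis
  proof (rule solvable_if_FP)
    fix x y assume xy: "(x, y) \<in> WMISP (free_tournaments H)"
    then have "solve_by_contraction f x = y"
      using solve_by_contraction_correct[OF f'] by (auto simp: WMISP_free_iff)
    with xy show "x \<in> ?D \<and> solve_by_contraction f x = y" by blast
  qed
qed

end
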